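(* Let $k$ be a field. Each of the six functors $\mathfrak{F}^{1}\colon \mathrm{rep}(\mathcal{S},k)\to\mathrm{rep}(\mathcal{F},k)$, $\mathfrak{F}^{2}\colon \mathrm{rep}(\mathcal{D},k)\to\mathrm{rep}(\mathcal{F},k)$, $\mathfrak{F}^{3}\colon \mathrm{rep}(\mathcal{K},k)\to\mathrm{rep}(\mathcal{F},k)$, $\mathfrak{F}^{4}\colon \mathrm{rep}(\mathcal{C},k)\to\mathrm{rep}(\mathcal{F},k)$, $\mathfrak{F}^{5}\colon \mathrm{lrel}(k)\to\mathrm{rep}(\mathcal{F},k)$ and $\mathfrak{F}^{6}\colon \mathrm{lrel}^{2}_{2}(k)\to\mathrm{rep}(\mathcal{F},k)$ is additive.
   Context: Throughout, $k$ is a field and all vector spaces are finite-dimensional over $k$; $\mathrm{rep}(Q,k)$ denotes the category of finite-dimensional representations over $k$ of a quiver $Q$. Quivers. $\mathcal{F}$: vertices $0,1,2,3,4$, arrows $\alpha\colon 1\to 0$, $\beta\colon 2\to 0$, $\gamma\colon 3\to 0$, $\delta\colon 4\to 0$; its representations are written $(V_0,V_1,V_2,V_3,V_4,f_\alpha,f_\beta,f_\gamma,f_\delta)$ and its morphisms $(l_0,l_1,l_2,l_3,l_4)$. $\mathcal{S}$: vertices $1,2,3,4$, arrows $\alpha\colon 3\to 1$, $\beta\colon 3\to 2$, $\gamma\colon 4\to 1$, $\delta\colon 4\to 2$. $\mathcal{D}$: vertices $1,2,3$, arrows $\alpha\colon 3\to 1$, $\beta\colon 3\to 2$, $\gamma\colon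 2\to 1$. $\mathcal{K}$: vertices $1,2$, arrows $\alpha,\beta\colon 2\to 1$. $\mathcal{C}$: vertices $1,2$, arrows $\alpha\colon 2\to 1$, $\beta\colon 1\to 2$. Linear relations. $\mathrm{lrel}(k)$: objects $\rho=(V_1,R)$ with $V_1$ a vector space and $R\subseteq V_1\oplus V_1$ a subspace; a morphism $(V_1,R)\to(W_1,S)$ is a linear map $l\colon V_1\to W_1$ such that $(x,y)\in R$ implies $(l(x),l(y))\in S$. $\mathrm{lrel}^2_2(k)$: objects $\rho=(V_1,V_2,R_1,R_2)$ with $R_1,R_2\subseteq V_1\oplus V_2$ subspaces; a morphism to $(W_1,W_2,S_1,S_2)$ is a pair of linear maps $l_i\colon V_i\to W_i$ such that $(x,y)\in R_i$ implies $(l_1(x),l_2(y))\in S_i$ for $i=1,2$. Both are additive categories with componentwise addition of morphisms and direct sums. Functors. In each case below except $\mathfrak{F}^5$, $V_0=V_1\oplus V_2$ and $\iota_i\colon V_i\to V_0$ are the canonical inclusions. - $\mathfrak{F}^1(V)=(V_0,V_1,V_2,V_3,V_4,\iota_1,\iota_2,\iota_1f_\alpha+\iota_2f_\beta,\iota_1f_\gamma+\iota_2f_\delta)$, $\mathfrak{F}^1(l)=(l_1\oplus l_2,l_1,l_2,l_3,l_4)$. - $\mathfrak{F}^2(V)=(V_0,V_1,V_2,V_3,V_2,\iota_1,\iota_2,\iota_1f_\alpha+\iota_2f_\beta,\iota_1f_\gamma+\iota_2)$, $\mathfrak{F}^2(l)=(l_1\oplus l_2,l_1,l_2,l_3,l_2)$.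 - $\mathfrak{F}^3(V)=(V_0,V_1,V_2,V_2,V_2,\iota_1,\iota_2,\iota_1f_\alpha+\iota_2,\iota_1f_\beta+\iota_2)$, $\mathfrak{F}^3(l)=(l_1\oplus l_2,l_1,l_2,l_2,l_2)$. - $\mathfrak{F}^4(V)=(V_0,V_1,V_2,V_1,V_2,\iota_1,\iota_2,\iota_1+\iota_2f_\beta,\iota_1f_\alpha+\iota_2)$, $\mathfrak{F}^4(l)=(l_1\oplus l_2,l_1,l_2,l_1,l_2)$. - $\mathfrak{F}^5(V_1,R)=(V_1\oplus V_1,V_1,V_1,V_1,R,\iota_1,\iota_2,\iota_1+\iota_2,j)$ with $\iota_1,\iota_2\colon V_1\to V_1\oplus V_1$ the two canonical inclusions and $j\colon R\to V_1\oplus V_1$ the inclusion; $\mathfrak{F}^5(l)=(l\oplus l,l,l,l,(l\oplus l)|_R)$. - $\mathfrak{F}^6(V_1,V_2,R_1,R_2)=(V_0,V_1,V_2,R_1,R_2,\iota_1,\iota_2,j_1,j_2)$ with $j_i\colon R_i\to V_0$ the inclusions; $\mathfrak{F}^6(l)=(l_1\oplus l_2,l_1,l_2,(l_1\oplus l_2)|_{R_1},(l_1\oplus l_2)|_{R_2})$. *)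

theory Defs
  imports
    "HOL-Library.FuncSet"
    "Jordan_Normal_Form.Missing_VectorSpace"
    "Graph_Theory.Digraph"
begin

text \<open>
  Each hom-set is packaged as a HOL-Algebra group record, so the operation written
  multiplicatively in \<^typ>\<open>'m monoid\<close> is the addition of morphisms and its unit is the
  zero morphism.  \<open>Comp C X Y Z g f\<close> is the composite of \<open>f : X \<rightarrow> Y\<close> and \<open>g : Y \<rightarrow> Z\<close>.
\<close>

record ('o, 'm) cat =
  Obj :: "'o set"
  Hom :: "'o \<Rightarrow> 'o \<Rightarrow> 'm monoid"
  Comp :: "'o \<Rightarrow> 'o \<Rightarrow> 'o \<Rightarrow> 'm \<Rightarrow> 'm \<Rightarrow> 'm"
  Ident :: "'o \<Rightarrow> 'm"

locale category =
  fixes C :: "('o, 'm) cat"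
  assumes ident_closed:
      "X \<in> Obj C \<Longrightarrow> Ident C X \<in> carrier (Hom C X X)"
    and comp_closed:
      "\<lbrakk>X \<in> Obj C; Y \<in> Obj C; Z \<in> Obj C; f \<in> carrier (Hom C X Y); g \<in> carrier (Hom C Y Z)\<rbrakk>
        \<Longrightarrow> Comp C X Y Z g f \<in> carrier (Hom C X Z)"
    and comp_ident_right:
      "\<lbrakk>X \<in> Obj C; Y \<in> Obj C; f \<in> carrier (Hom C X Y)\<rbrakk> \<Longrightarrow> Comp C X X Y f (Ident C X) = f"
    and comp_ident_left:
      "\<lbrakk>X \<in> Obj C; Y \<in> Obj C; f \<in> carrier (Hom C X Y)\<rbrakk> \<Longrightarrow> Comp C X Y Y (Ident C Y) f = f"
    and comp_assoc:
      "\<lbrakk>W \<in> Obj C; X \<in> Obj C; Y \<in> Obj C; Z \<in> Obj C;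
        f \<in> carrier (Hom C W X); g \<in> carrier (Hom C X Y); h \<in> carrier (Hom C Y Z)\<rbrakk>
        \<Longrightarrow> Comp C W Y Z h (Comp C W X Y g f) = Comp C W X Z (Comp C X Y Z h g) f"

locale preadditive_category = category +
  assumes hom_comm_group:
      "\<lbrakk>X \<in> Obj C; Y \<in> Obj C\<rbrakk> \<Longrightarrow> comm_group (Hom C X Y)"
    and comp_add_left:
      "\<lbrakk>X \<in> Obj C; Y \<in> Obj C; Z \<in> Obj C; f \<in> carrier (Hom C X Y);
        g \<in> carrier (Hom C Y Z); g' \<in> carrier (Hom C Y Z)\<rbrakk>
        \<Longrightarrow> Comp C X Y Z (g \<otimes>\<^bsub>Hom C Y Z\<^esub> g') f
          = Comp C X Y Z g f \<otimes>\<^bsub>Hom C X Z\<^esub> Comp C X Y Z g' f"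
    and comp_add_right:
      "\<lbrakk>X \<in> Obj C; Y \<in> Obj C; Z \<in> Obj C; f \<in> carrier (Hom C X Y); f' \<in> carrier (Hom C X Y);
        g \<in> carrier (Hom C Y Z)\<rbrakk>
        \<Longrightarrow> Comp C X Y Z g (f \<otimes>\<^bsub>Hom C X Y\<^esub> f')
          = Comp C X Y Z g f \<otimes>\<^bsub>Hom C X Z\<^esub> Comp C X Y Z g f'"

definition zero_object :: "('o, 'm) cat \<Rightarrow> 'o \<Rightarrow> bool" where
  "zero_object C Z \<longleftrightarrow> Z \<in> Obj C \<and>
    (\<forall>X\<in>Obj C. (\<exists>!f. f \<in> carrier (Hom C X Z)) \<and> (\<exists>!f. f \<in> carrier (Hom C Z X)))"

definition biproduct ::
  "('o, 'm) cat \<Rightarrow> 'o \<Rightarrow> 'o \<Rightarrow> 'o \<Rightarrow> 'm \<Rightarrow> 'm \<Rightarrow> 'm \<Rightarrow> 'm \<Rightarrow> bool" where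
  "biproduct C X Y P i1 i2 p1 p2 \<longleftrightarrow> P \<in> Obj C \<and>
    i1 \<in> carrier (Hom C X P) \<and> i2 \<in> carrier (Hom C Y P) \<and>
    p1 \<in> carrier (Hom C P X) \<and> p2 \<in> carrier (Hom C P Y) \<and>
    Comp C X P X p1 i1 = Ident C X \<and> Comp C Y P Y p2 i2 = Ident C Y \<and>
    Comp C X P Y p2 i1 = \<one>\<^bsub>Hom C X Y\<^esub> \<and> Comp C Y P X p1 i2 = \<one>\<^bsub>Hom C Y X\<^esub> \<and>
    Comp C P X P i1 p1 \<otimes>\<^bsub>Hom C P P\<^esub> Comp C P Y P i2 p2 = Ident C P"

locale additive_category = preadditive_category +
  assumes ex_zero_object: "\<exists>Z. zero_object C Z"
    and ex_biproduct:
      "\<lbrakk>X \<in> Obj C; Y \<in> Obj C\<rbrakk> \<Longrightarrow> \<exists>P i1 i2 p1 p2. biproduct C X Y P i1 i2 p1 p2"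

record ('o, 'm, 'p, 'n) functor_data =
  on_obj :: "'o \<Rightarrow> 'p"
  on_hom :: "'o \<Rightarrow> 'o \<Rightarrow> 'm \<Rightarrow> 'n"

locale cat_functor = C: category C + D: category D
  for C :: "('o, 'm) cat" and D :: "('p, 'n) cat" +
  fixes F :: "('o, 'm, 'p, 'n) functor_data"
  assumes on_obj_closed: "X \<in> Obj C \<Longrightarrow> on_obj F X \<in> Obj D"
    and on_hom_closed:
      "\<lbrakk>X \<in> Obj C; Y \<in> Obj C; f \<in> carrier (Hom C X Y)\<rbrakk>
        \<Longrightarrow> on_hom F X Y f \<in> carrier (Hom D (on_obj F X) (on_obj F Y))"
    and on_hom_ident:
      "X \<in> Obj C \<Longrightarrow> on_hom F X X (Ident C X) = Ident D (on_obj F X)"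
    and on_hom_comp:
      "\<lbrakk>X \<in> Obj C; Y \<in> Obj C; Z \<in> Obj C; f \<in> carrier (Hom C X Y); g \<in> carrier (Hom C Y Z)\<rbrakk>
        \<Longrightarrow> on_hom F X Z (Comp C X Y Z g f)
          = Comp D (on_obj F X) (on_obj F Y) (on_obj F Z) (on_hom F Y Z g) (on_hom F X Y f)"

locale additive_functor =
  C: additive_category C + D: additive_category D + cat_functor C D F
  for C :: "('o, 'm) cat" and D :: "('p, 'n) cat" and F :: "('o, 'm, 'p, 'n) functor_data" +
  assumes on_hom_additive:
      "\<lbrakk>X \<in> Obj C; Y \<in> Obj C\<rbrakk>
        \<Longrightarrow> on_hom F X Y \<in> hom (Hom C X Y) (Hom D (on_obj F X) (on_obj F Y))"

text \<open>
  Categories need all their objects in one type, and that type must be closed under forming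
  direct sums.  Vectors are therefore binary trees over an arbitrary type of atoms: every set
  of vectors in \<^typ>\<open>'a\<close> embeds through \<open>Atom\<close>, and \<open>UPair\<close> plays the role of the
  ordered pair.  The fields \<open>mult\<close> and \<open>one\<close> which modules inherit from rings are
  never used.
\<close>

datatype 'a univ = Atom 'a | UPair (ufst: "'a univ") (usnd: "'a univ")

type_synonym ('k, 'a) vs = "('k, 'a univ) module"
type_synonym 'a map = "'a univ \<Rightarrow> 'a univ"

definition fdvs :: "'k ring \<Rightarrow> ('k, 'a) vs set" where
  "fdvs K = {V. vectorspace K V \<and> vectorspace.fin_dim K V}"

text \<open>Linear maps are extensional, so that HOL equality is equality of maps on the carrier.\<close>

definition lin :: "'k ring \<Rightarrow> ('k, 'a) vs \<Rightarrow> ('k, 'a) vs \<Rightarrow> 'a map set" where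
  "lin K V W = LinearCombinations.module_hom K V W \<inter> extensional (carrier V)"

definition id_map :: "('k, 'a) vs \<Rightarrow> 'a map" where
  "id_map V = (\<lambda>x\<in>carrier V. x)"

definition add_map :: "('k, 'a) vs \<Rightarrow> ('k, 'a) vs \<Rightarrow> 'a map \<Rightarrow> 'a map \<Rightarrow> 'a map" where
  "add_map V W f g = (\<lambda>x\<in>carrier V. f x \<oplus>\<^bsub>W\<^esub> g x)"

definition zero_map :: "('k, 'a) vs \<Rightarrow> ('k, 'a) vs \<Rightarrow> 'a map" where
  "zero_map V W = (\<lambda>x\<in>carrier V. \<zero>\<^bsub>W\<^esub>)"

definition comp_map :: "('k, 'a) vs \<Rightarrow> 'a map \<Rightarrow> 'a map \<Rightarrow> 'a map" where
  "comp_map V g f = compose (carrier V) g f"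

definition dsum :: "('k, 'a) vs \<Rightarrow> ('k, 'a) vs \<Rightarrow> ('k, 'a) vs" where
  "dsum V W =
    \<lparr>carrier = {UPair x y | x y. x \<in> carrier V \<and> y \<in> carrier W},
     mult = (\<lambda>p q. UPair \<zero>\<^bsub>V\<^esub> \<zero>\<^bsub>W\<^esub>),
     one = UPair \<zero>\<^bsub>V\<^esub> \<zero>\<^bsub>W\<^esub>,
     zero = UPair \<zero>\<^bsub>V\<^esub> \<zero>\<^bsub>W\<^esub>,
     add = (\<lambda>p q. UPair (ufst p \<oplus>\<^bsub>V\<^esub> ufst q) (usnd p \<oplus>\<^bsub>W\<^esub> usnd q)),
     smult = (\<lambda>c p. UPair (c \<odot>\<^bsub>V\<^esub> ufst p) (c \<odot>\<^bsub>W\<^esub> usnd p))\<rparr>"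

definition incl1 :: "('k, 'a) vs \<Rightarrow> ('k, 'a) vs \<Rightarrow> 'a map" where
  "incl1 V W = (\<lambda>x\<in>carrier V. UPair x \<zero>\<^bsub>W\<^esub>)"

definition incl2 :: "('k, 'a) vs \<Rightarrow> ('k, 'a) vs \<Rightarrow> 'a map" where
  "incl2 V W = (\<lambda>y\<in>carrier W. UPair \<zero>\<^bsub>V\<^esub> y)"

definition dsum_map :: "('k, 'a) vs \<Rightarrow> ('k, 'a) vs \<Rightarrow> 'a map \<Rightarrow> 'a map \<Rightarrow> 'a map" where
  "dsum_map V W f g = (\<lambda>p\<in>carrier (dsum V W). UPair (f (ufst p)) (g (usnd p)))"

text \<open>A quiver is a directed multigraph; an arrow \<open>e\<close> goes from \<open>tail Q e\<close> to \<open>head Q e\<close>.\<close>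

record ('v, 'e, 'k, 'a) rep =
  vspace :: "'v \<Rightarrow> ('k, 'a) vs"
  vmap :: "'e \<Rightarrow> 'a map"

type_synonym ('v, 'e, 'k, 'a) rep_category = "(('v, 'e, 'k, 'a) rep, 'v \<Rightarrow> 'a map) cat"

definition rep_obj :: "'k ring \<Rightarrow> ('v, 'e) pre_digraph \<Rightarrow> ('v, 'e, 'k, 'a) rep set" where
  "rep_obj K Q = {V. vspace V \<in> verts Q \<rightarrow>\<^sub>E fdvs K \<and>
    vmap V \<in> (\<Pi>\<^sub>E e\<in>arcs Q. lin K (vspace V (tail Q e)) (vspace V (head Q e)))}"

definition rep_mor :: "'k ring \<Rightarrow> ('v, 'e) pre_digraph \<Rightarrow>
    ('v, 'e, 'k, 'a) rep \<Rightarrow> ('v, 'e, 'k, 'a) rep \<Rightarrow> ('v \<Rightarrow> 'a map) set" where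
  "rep_mor K Q V W = {l \<in> (\<Pi>\<^sub>E i\<in>verts Q. lin K (vspace V i) (vspace W i)).
    \<forall>e\<in>arcs Q. comp_map (vspace V (tail Q e)) (l (head Q e)) (vmap V e)
             = comp_map (vspace V (tail Q e)) (vmap W e) (l (tail Q e))}"

definition rep_cat :: "'k ring \<Rightarrow> ('v, 'e) pre_digraph \<Rightarrow> ('v, 'e, 'k, 'a) rep_category" where
  "rep_cat K Q =
    \<lparr>Obj = rep_obj K Q,
     Hom = (\<lambda>V W.
       \<lparr>carrier = rep_mor K Q V W,
        mult = (\<lambda>l m. \<lambda>i\<in>verts Q. add_map (vspace V i) (vspace W i) (l i) (m i)),
        one = (\<lambda>i\<in>verts Q. zero_map (vspace V i) (vspace W i))\<rparr>),
     Comp = (\<lambda>U V W m l. \<lambda>i\<in>verts Q. comp_map (vspace U i) (m i) (l i)),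
     Ident = (\<lambda>V. \<lambda>i\<in>verts Q. id_map (vspace V i))\<rparr>"

datatype arrow = Alpha | Beta | Gamma | Delta

type_synonym quiver = "(nat, arrow) pre_digraph"

definition quiver_F :: quiver where
  "quiver_F =
    \<lparr>verts = {0, 1, 2, 3, 4},
     arcs = {Alpha, Beta, Gamma, Delta},
     tail = undefined(Alpha := 1, Beta := 2, Gamma := 3, Delta := 4),
     head = undefined(Alpha := 0, Beta := 0, Gamma := 0, Delta := 0)\<rparr>"

definition quiver_S :: quiver where
  "quiver_S =
    \<lparr>verts = {1, 2, 3, 4},
     arcs = {Alpha, Beta, Gamma, Delta},
     tail = undefined(Alpha := 3, Beta := 3, Gamma := 4, Delta := 4),
     head = undefined(Alpha := 1, Beta := 2, Gamma := 1, Delta := 2)\<rparr>"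

definition quiver_D :: quiver where
  "quiver_D =
    \<lparr>verts = {1, 2, 3},
     arcs = {Alpha, Beta, Gamma},
     tail = undefined(Alpha := 3, Beta := 3, Gamma := 2),
     head = undefined(Alpha := 1, Beta := 2, Gamma := 1)\<rparr>"

definition quiver_K :: quiver where
  "quiver_K =
    \<lparr>verts = {1, 2},
     arcs = {Alpha, Beta},
     tail = undefined(Alpha := 2, Beta := 2),
     head = undefined(Alpha := 1, Beta := 1)\<rparr>"

definition quiver_C :: quiver where
  "quiver_C =
    \<lparr>verts = {1, 2},
     arcs = {Alpha, Beta},
     tail = undefined(Alpha := 2, Beta := 1),
     head = undefined(Alpha := 1, Beta := 2)\<rparr>"

type_synonym ('k, 'a) lrel_object = "('k, 'a) vs \<times> 'a univ set"
type_synonym ('k, 'a) lrel2_object =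
  "('k, 'a) vs \<times> ('k, 'a) vs \<times> 'a univ set \<times> 'a univ set"

definition lrel_cat :: "'k ring \<Rightarrow> (('k, 'a) lrel_object, 'a map) cat" where
  "lrel_cat K =
    \<lparr>Obj = {(V, R). V \<in> fdvs K \<and> VectorSpace.subspace K R (dsum V V)},
     Hom = (\<lambda>(V, R) (W, S).
       \<lparr>carrier = {l \<in> lin K V W. \<forall>x y. UPair x y \<in> R \<longrightarrow> UPair (l x) (l y) \<in> S},
        mult = add_map V W,
        one = zero_map V W\<rparr>),
     Comp = (\<lambda>(U, Q) (V, R) (W, S) m l. comp_map U m l),
     Ident = (\<lambda>(V, R). id_map V)\<rparr>"

definition lrel2_cat :: "'k ring \<Rightarrow> (('k, 'a) lrel2_object, 'a map \<times> 'a map) cat" where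
  "lrel2_cat K =
    \<lparr>Obj = {(V1, V2, R1, R2). V1 \<in> fdvs K \<and> V2 \<in> fdvs K \<and>
       VectorSpace.subspace K R1 (dsum V1 V2) \<and> VectorSpace.subspace K R2 (dsum V1 V2)},
     Hom = (\<lambda>(V1, V2, R1, R2) (W1, W2, S1, S2).
       \<lparr>carrier = {(l1, l2). l1 \<in> lin K V1 W1 \<and> l2 \<in> lin K V2 W2 \<and>
          (\<forall>x y. UPair x y \<in> R1 \<longrightarrow> UPair (l1 x) (l2 y) \<in> S1) \<and>
          (\<forall>x y. UPair x y \<in> R2 \<longrightarrow> UPair (l1 x) (l2 y) \<in> S2)},
        mult = (\<lambda>(l1, l2) (m1, m2). (add_map V1 W1 l1 m1, add_map V2 W2 l2 m2)),
        one = (zero_map V1 W1, zero_map V2 W2)\<rparr>),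
     Comp = (\<lambda>(U1, U2, Q1, Q2) Y Z (m1, m2) (l1, l2). (comp_map U1 m1 l1, comp_map U2 m2 l2)),
     Ident = (\<lambda>(V1, V2, R1, R2). (id_map V1, id_map V2))\<rparr>"

definition F_rep ::
  "('k, 'a) vs \<Rightarrow> ('k, 'a) vs \<Rightarrow> ('k, 'a) vs \<Rightarrow> ('k, 'a) vs \<Rightarrow> ('k, 'a) vs \<Rightarrow>
   'a map \<Rightarrow> 'a map \<Rightarrow> 'a map \<Rightarrow> 'a map \<Rightarrow> (nat, arrow, 'k, 'a) rep" where
  "F_rep V0 V1 V2 V3 V4 fa fb fc fd =
    \<lparr>vspace = (\<lambda>_. undefined)(0 := V0, 1 := V1, 2 := V2, 3 := V3, 4 := V4),
     vmap = (\<lambda>_. undefined)(Alpha := fa, Beta := fb, Gamma := fc, Delta := fd)\<rparr>"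

definition F_mor ::
  "'a map \<Rightarrow> 'a map \<Rightarrow> 'a map \<Rightarrow> 'a map \<Rightarrow> 'a map \<Rightarrow> nat \<Rightarrow> 'a map" where
  "F_mor l0 l1 l2 l3 l4 = (\<lambda>_. undefined)(0 := l0, 1 := l1, 2 := l2, 3 := l3, 4 := l4)"

type_synonym ('k, 'a) rep_functor =
  "((nat, arrow, 'k, 'a) rep, nat \<Rightarrow> 'a map, (nat, arrow, 'k, 'a) rep, nat \<Rightarrow> 'a map) functor_data"

definition functor1 :: "('k, 'a) rep_functor" where
  "functor1 =
    \<lparr>on_obj = (\<lambda>V.
       let V1 = vspace V 1; V2 = vspace V 2; V3 = vspace V 3; V4 = vspace V 4;
           V0 = dsum V1 V2; i1 = incl1 V1 V2; i2 = incl2 V1 V2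
       in F_rep V0 V1 V2 V3 V4 i1 i2
            (add_map V3 V0 (comp_map V3 i1 (vmap V Alpha)) (comp_map V3 i2 (vmap V Beta)))
            (add_map V4 V0 (comp_map V4 i1 (vmap V Gamma)) (comp_map V4 i2 (vmap V Delta)))),
     on_hom = (\<lambda>V W l.
       F_mor (dsum_map (vspace V 1) (vspace V 2) (l 1) (l 2)) (l 1) (l 2) (l 3) (l 4))\<rparr>"

definition functor2 :: "('k, 'a) rep_functor" where
  "functor2 =
    \<lparr>on_obj = (\<lambda>V.
       let V1 = vspace V 1; V2 = vspace V 2; V3 = vspace V 3;
           V0 = dsum V1 V2; i1 = incl1 V1 V2; i2 = incl2 V1 V2
       in F_rep V0 V1 V2 V3 V2 i1 i2
            (add_map V3 V0 (comp_map V3 i1 (vmap V Alpha)) (comp_map V3 i2 (vmap V Beta)))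
            (add_map V2 V0 (comp_map V2 i1 (vmap V Gamma)) i2)),
     on_hom = (\<lambda>V W l.
       F_mor (dsum_map (vspace V 1) (vspace V 2) (l 1) (l 2)) (l 1) (l 2) (l 3) (l 2))\<rparr>"

definition functor3 :: "('k, 'a) rep_functor" where
  "functor3 =
    \<lparr>on_obj = (\<lambda>V.
       let V1 = vspace V 1; V2 = vspace V 2;
           V0 = dsum V1 V2; i1 = incl1 V1 V2; i2 = incl2 V1 V2
       in F_rep V0 V1 V2 V2 V2 i1 i2
            (add_map V2 V0 (comp_map V2 i1 (vmap V Alpha)) i2)
            (add_map V2 V0 (comp_map V2 i1 (vmap V Beta)) i2)),
     on_hom = (\<lambda>V W l.
       F_mor (dsum_map (vspace V 1) (vspace V 2) (l 1) (l 2)) (l 1) (l 2) (l 2) (l 2))\<rparr>"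

definition functor4 :: "('k, 'a) rep_functor" where
  "functor4 =
    \<lparr>on_obj = (\<lambda>V.
       let V1 = vspace V 1; V2 = vspace V 2;
           V0 = dsum V1 V2; i1 = incl1 V1 V2; i2 = incl2 V1 V2
       in F_rep V0 V1 V2 V1 V2 i1 i2
            (add_map V1 V0 i1 (comp_map V1 i2 (vmap V Beta)))
            (add_map V2 V0 (comp_map V2 i1 (vmap V Alpha)) i2)),
     on_hom = (\<lambda>V W l.
       F_mor (dsum_map (vspace V 1) (vspace V 2) (l 1) (l 2)) (l 1) (l 2) (l 1) (l 2))\<rparr>"

definition functor5 ::
  "(('k, 'a) lrel_object, 'a map, (nat, arrow, 'k, 'a) rep, nat \<Rightarrow> 'a map) functor_data" where
  "functor5 =
    \<lparr>on_obj = (\<lambda>(V, R).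
       let V0 = dsum V V; i1 = incl1 V V; i2 = incl2 V V
       in F_rep V0 V V V (V0\<lparr>carrier := R\<rparr>) i1 i2 (add_map V V0 i1 i2) (\<lambda>x\<in>R. x)),
     on_hom = (\<lambda>(V, R) (W, S) l.
       F_mor (dsum_map V V l l) l l l (restrict (dsum_map V V l l) R))\<rparr>"

definition functor6 ::
  "(('k, 'a) lrel2_object, 'a map \<times> 'a map, (nat, arrow, 'k, 'a) rep, nat \<Rightarrow> 'a map) functor_data"
  where
  "functor6 =
    \<lparr>on_obj = (\<lambda>(V1, V2, R1, R2).
       let V0 = dsum V1 V2
       in F_rep V0 V1 V2 (V0\<lparr>carrier := R1\<rparr>) (V0\<lparr>carrier := R2\<rparr>)
            (incl1 V1 V2) (incl2 V1 V2) (\<lambda>x\<in>R1. x) (\<lambda>x\<in>R2. x)),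
     on_hom = (\<lambda>(V1, V2, R1, R2) Y (l1, l2).
       let l0 = dsum_map V1 V2 l1 l2
       in F_mor l0 l1 l2 (restrict l0 R1) (restrict l0 R2))\<rparr>"

end

theory Submission
  imports Defs
begin

text \<open>
  Morphisms of representations are added and composed vertexwise, and the direct sum of
  vector spaces, with its inclusions and projections, gives biproducts of representations and of
  linear relations.  For each of the six functors the component at vertex 0 is
  \<open>l\<^sub>1 \<oplus> l\<^sub>2\<close>, which is functorial and additive in the pair, and every other component is
  either a component of the given morphism or the restriction of \<open>l\<^sub>1 \<oplus> l\<^sub>2\<close> to a relation that
  the morphism preserves.  Compatibility with \<open>\<alpha>\<close> and \<open>\<beta>\<close> is then automatic, so only the arrows
  \<open>\<gamma>\<close> and \<open>\<delta>\<close> have to be checked.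
\<close>

section \<open>Linear algebra\<close>

text \<open>The locale \<open>additive_functor\<close> also asks that source and target be additive
  categories, so hom-groups, zero objects and biproducts make up more of the proof than the functors
  themselves. Compatibility with \<alpha> and \<beta> is automatic because
  \<open>l1 \<oplus> l2\<close> sends \<open>(x, 0)\<close> to \<open>(l1 x, l2 0)\<close> and
  linear maps send zero to zero; symmetrically for \<open>(0, y)\<close>.

  Two obstacles shape the rest. A relation placed at a vertex has to be a finite-dimensional space,
  while finite dimension is defined by a finite generating set, which a subspace does not inherit
  directly; hence the detour through maximal independent sets. And equality of morphisms is equality
  of extensional functions: a composite taken on \<open>V\<close> or a restriction to
  \<open>R\<close> is \<open>undefined\<close> elsewhere. Laws about composites therefore carry
  hypotheses saying that the inner map lands in the domain of the outer one, and for restrictions to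
  relations that hypothesis is exactly preservation of the relation.\<close>

locale ground_field =
  fixes K :: "'k ring"
  assumes field_K: "field K"
begin

section \<open>Vector space laws and finite dimension\<close>

lemma fdvs_vectorspace: "V \<in> fdvs K \<Longrightarrow> vectorspace K V"
  by (simp add: fdvs_def)

lemma fdvs_module: "V \<in> fdvs K \<Longrightarrow> Module.module K V"
  by (auto simp: fdvs_def vectorspace_def)

text \<open>The module laws are restated with membership in \<open>fdvs K\<close> as the premise
  about the space, so that the simplifier can apply them to many spaces at once, such as a family
  indexed by vertices, without a locale interpretation for each. \<open>vs_neg_eq\<close> reduces
  negatives to scalar multiples, which linear maps and subspaces respect by definition.\<close>

lemma
  assumes "V \<in> fdvs K"
  shows vs_zero_closed [simp]: "\<zero>\<^bsub>V\<^esub> \<in> carrier V"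
    and vs_add_closed [simp]: "\<lbrakk>x \<in> carrier V; y \<in> carrier V\<rbrakk> \<Longrightarrow> x \<oplus>\<^bsub>V\<^esub> y \<in> carrier V"
    and vs_neg_closed [simp]: "x \<in> carrier V \<Longrightarrow> \<ominus>\<^bsub>V\<^esub> x \<in> carrier V"
    and vs_smult_closed [simp]: "\<lbrakk>c \<in> carrier K; x \<in> carrier V\<rbrakk> \<Longrightarrow> c \<odot>\<^bsub>V\<^esub> x \<in> carrier V"
    and vs_l_zero [simp]: "x \<in> carrier V \<Longrightarrow> \<zero>\<^bsub>V\<^esub> \<oplus>\<^bsub>V\<^esub> x = x"
    and vs_r_zero [simp]: "x \<in> carrier V \<Longrightarrow> x \<oplus>\<^bsub>V\<^esub> \<zero>\<^bsub>V\<^esub> = x"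
    and vs_l_neg [simp]: "x \<in> carrier V \<Longrightarrow> \<ominus>\<^bsub>V\<^esub> x \<oplus>\<^bsub>V\<^esub> x = \<zero>\<^bsub>V\<^esub>"
    and vs_r_neg [simp]: "x \<in> carrier V \<Longrightarrow> x \<oplus>\<^bsub>V\<^esub> \<ominus>\<^bsub>V\<^esub> x = \<zero>\<^bsub>V\<^esub>"
    and vs_smult_zero [simp]: "c \<in> carrier K \<Longrightarrow> c \<odot>\<^bsub>V\<^esub> \<zero>\<^bsub>V\<^esub> = \<zero>\<^bsub>V\<^esub>"
    and vs_zero_smult [simp]: "x \<in> carrier V \<Longrightarrow> \<zero>\<^bsub>K\<^esub> \<odot>\<^bsub>V\<^esub> x = \<zero>\<^bsub>V\<^esub>"
    and vs_one_smult [simp]: "x \<in> carrier V \<Longrightarrow> \<one>\<^bsub>K\<^esub> \<odot>\<^bsub>V\<^esub> x = x"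
    and vs_neg_eq: "x \<in> carrier V \<Longrightarrow> \<ominus>\<^bsub>V\<^esub> x = (\<ominus>\<^bsub>K\<^esub> \<one>\<^bsub>K\<^esub>) \<odot>\<^bsub>V\<^esub> x"
    and vs_add_assoc: "\<lbrakk>x \<in> carrier V; y \<in> carrier V; z \<in> carrier V\<rbrakk>
      \<Longrightarrow> (x \<oplus>\<^bsub>V\<^esub> y) \<oplus>\<^bsub>V\<^esub> z = x \<oplus>\<^bsub>V\<^esub> (y \<oplus>\<^bsub>V\<^esub> z)"
    and vs_add_comm: "\<lbrakk>x \<in> carrier V; y \<in> carrier V\<rbrakk> \<Longrightarrow> x \<oplus>\<^bsub>V\<^esub> y = y \<oplus>\<^bsub>V\<^esub> x"
    and vs_add_left_comm: "\<lbrakk>x \<in> carrier V; y \<in> carrier V; z \<in> carrier V\<rbrakk>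
      \<Longrightarrow> x \<oplus>\<^bsub>V\<^esub> (y \<oplus>\<^bsub>V\<^esub> z) = y \<oplus>\<^bsub>V\<^esub> (x \<oplus>\<^bsub>V\<^esub> z)"
    and vs_smult_add: "\<lbrakk>c \<in> carrier K; x \<in> carrier V; y \<in> carrier V\<rbrakk>
      \<Longrightarrow> c \<odot>\<^bsub>V\<^esub> (x \<oplus>\<^bsub>V\<^esub> y) = c \<odot>\<^bsub>V\<^esub> x \<oplus>\<^bsub>V\<^esub> c \<odot>\<^bsub>V\<^esub> y"
    and vs_smult_add_left: "\<lbrakk>c \<in> carrier K; d \<in> carrier K; x \<in> carrier V\<rbrakk>
      \<Longrightarrow> (c \<oplus>\<^bsub>K\<^esub> d) \<odot>\<^bsub>V\<^esub> x = c \<odot>\<^bsub>V\<^esub> x \<oplus>\<^bsub>V\<^esub> d \<odot>\<^bsub>V\<^esub> x"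
    and vs_smult_smult: "\<lbrakk>c \<in> carrier K; d \<in> carrier K; x \<in> carrier V\<rbrakk>
      \<Longrightarrow> c \<odot>\<^bsub>V\<^esub> (d \<odot>\<^bsub>V\<^esub> x) = (c \<otimes>\<^bsub>K\<^esub> d) \<odot>\<^bsub>V\<^esub> x"
proof -
  interpret Module.module K V by (rule fdvs_module [OF assms])
  show "\<zero>\<^bsub>V\<^esub> \<in> carrier V" by simp
  show "\<lbrakk>x \<in> carrier V; y \<in> carrier V\<rbrakk> \<Longrightarrow> x \<oplus>\<^bsub>V\<^esub> y \<in> carrier V" by simp
  show "x \<in> carrier V \<Longrightarrow> \<ominus>\<^bsub>V\<^esub> x \<in> carrier V" by simp
  show "\<lbrakk>c \<in> carrier K; x \<in> carrier V\<rbrakk> \<Longrightarrow> c \<odot>\<^bsub>V\<^esub> x \<in> carrier V" by simp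
  show "x \<in> carrier V \<Longrightarrow> \<zero>\<^bsub>V\<^esub> \<oplus>\<^bsub>V\<^esub> x = x" by simp
  show "x \<in> carrier V \<Longrightarrow> x \<oplus>\<^bsub>V\<^esub> \<zero>\<^bsub>V\<^esub> = x" by simp
  show "x \<in> carrier V \<Longrightarrow> \<ominus>\<^bsub>V\<^esub> x \<oplus>\<^bsub>V\<^esub> x = \<zero>\<^bsub>V\<^esub>" by (rule M.l_neg)
  show "x \<in> carrier V \<Longrightarrow> x \<oplus>\<^bsub>V\<^esub> \<ominus>\<^bsub>V\<^esub> x = \<zero>\<^bsub>V\<^esub>" by (rule M.r_neg)
  show "c \<in> carrier K \<Longrightarrow> c \<odot>\<^bsub>V\<^esub> \<zero>\<^bsub>V\<^esub> = \<zero>\<^bsub>V\<^esub>" by simp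
  show "x \<in> carrier V \<Longrightarrow> \<zero>\<^bsub>K\<^esub> \<odot>\<^bsub>V\<^esub> x = \<zero>\<^bsub>V\<^esub>" by simp
  show "x \<in> carrier V \<Longrightarrow> \<one>\<^bsub>K\<^esub> \<odot>\<^bsub>V\<^esub> x = x" by simp
  show "x \<in> carrier V \<Longrightarrow> \<ominus>\<^bsub>V\<^esub> x = (\<ominus>\<^bsub>K\<^esub> \<one>\<^bsub>K\<^esub>) \<odot>\<^bsub>V\<^esub> x" by (simp add: smult_minus_1)
  show "\<lbrakk>x \<in> carrier V; y \<in> carrier V; z \<in> carrier V\<rbrakk>
      \<Longrightarrow> (x \<oplus>\<^bsub>V\<^esub> y) \<oplus>\<^bsub>V\<^esub> z = x \<oplus>\<^bsub>V\<^esub> (y \<oplus>\<^bsub>V\<^esub> z)" by (rule M.a_assoc)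
  show "\<lbrakk>x \<in> carrier V; y \<in> carrier V\<rbrakk> \<Longrightarrow> x \<oplus>\<^bsub>V\<^esub> y = y \<oplus>\<^bsub>V\<^esub> x" by (rule M.a_comm)
  show "\<lbrakk>x \<in> carrier V; y \<in> carrier V; z \<in> carrier V\<rbrakk>
      \<Longrightarrow> x \<oplus>\<^bsub>V\<^esub> (y \<oplus>\<^bsub>V\<^esub> z) = y \<oplus>\<^bsub>V\<^esub> (x \<oplus>\<^bsub>V\<^esub> z)" by (rule M.a_lcomm)
  show "\<lbrakk>c \<in> carrier K; x \<in> carrier V; y \<in> carrier V\<rbrakk>
      \<Longrightarrow> c \<odot>\<^bsub>V\<^esub> (x \<oplus>\<^bsub>V\<^esub> y) = c \<odot>\<^bsub>V\<^esub> x \<oplus>\<^bsub>V\<^esub> c \<odot>\<^bsub>V\<^esub> y" by (rule smult_r_distr)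
  show "\<lbrakk>c \<in> carrier K; d \<in> carrier K; x \<in> carrier V\<rbrakk>
      \<Longrightarrow> (c \<oplus>\<^bsub>K\<^esub> d) \<odot>\<^bsub>V\<^esub> x = c \<odot>\<^bsub>V\<^esub> x \<oplus>\<^bsub>V\<^esub> d \<odot>\<^bsub>V\<^esub> x" by (rule smult_l_distr)
  show "\<lbrakk>c \<in> carrier K; d \<in> carrier K; x \<in> carrier V\<rbrakk>
      \<Longrightarrow> c \<odot>\<^bsub>V\<^esub> (d \<odot>\<^bsub>V\<^esub> x) = (c \<otimes>\<^bsub>K\<^esub> d) \<odot>\<^bsub>V\<^esub> x" by (simp add: smult_assoc1)
qed

text \<open>Generation by \<open>A\<close> is phrased through submodules: whatever submodule
  contains \<open>A\<close> is everything. This form, with its converse \<open>fdvsE\<close>, keeps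
  linear combinations out of the argument for direct sums.\<close>

lemma fdvsI:
  assumes "Module.module K V" "finite A" "A \<subseteq> carrier V"
    and gen: "\<And>N. \<lbrakk>submodule K N V; A \<subseteq> N\<rbrakk> \<Longrightarrow> carrier V \<subseteq> N"
  shows "V \<in> fdvs K"
proof -
  interpret vectorspace K V using assms field_K by (simp add: vectorspace_def)
  have "carrier V \<subseteq> span A"
    using assms by (intro gen span_is_submodule in_own_span)
  then have "span A = carrier V"
    using span_is_subset2 [OF \<open>A \<subseteq> carrier V\<close>] by blast
  then show ?thesis
    using assms vectorspace_axioms by (auto simp: fdvs_def fin_dim_def)
qed

lemma fdvsE:
  assumes "V \<in> fdvs K"
  obtains A where "finite A" "A \<subseteq> carrier V"
    and "\<And>N. \<lbrakk>submodule K N V; A \<subseteq> N\<rbrakk> \<Longrightarrow> carrier V \<subseteq> N"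
proof -
  interpret vectorspace K V by (rule fdvs_vectorspace [OF assms])
  from assms obtain A where "finite A" "A \<subseteq> carrier V" "span A = carrier V"
    by (auto simp: fdvs_def fin_dim_def)
  then show ?thesis using that span_is_subset by metis
qed

text \<open>Linear independence in \<open>R\<close> agrees with that in \<open>V\<close>, so the
  dimension of \<open>V\<close> bounds the size of independent subsets of \<open>R\<close>. A
  maximal one therefore exists, is finite and generates \<open>R\<close>. This is what lets
  \<open>functor5\<close> and \<open>functor6\<close> place relations at vertices.\<close>

lemma fdvs_subspace:
  assumes V: "V \<in> fdvs K" and R: "VectorSpace.subspace K R V"
  shows "V\<lparr>carrier := R\<rparr> \<in> fdvs K"
proof -
  interpret V: vectorspace K V by (rule fdvs_vectorspace [OF V])
  interpret R: vectorspace K "V\<lparr>carrier := R\<rparr>" by (rule V.subspace_is_vs [OF R])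
  have sub: "submodule K R V" using R by (simp add: subspace_def)
  then have RV: "R \<subseteq> carrier V" by (simp add: submodule_def)
  have fin: "V.fin_dim" using V by (simp add: fdvs_def)
  have indep: "R.lin_dep S = V.lin_dep S" if "S \<subseteq> R" for S
    by (rule V.span_li_not_depend(2) [OF that sub])
  have "\<exists>A. finite A \<and> maximal A (\<lambda>S. S \<subseteq> carrier (V\<lparr>carrier := R\<rparr>) \<and> R.lin_indpt S)"
  proof (rule maximal_exists [where B = "{}" and N = V.dim])
    fix S assume S: "S \<subseteq> carrier (V\<lparr>carrier := R\<rparr>) \<and> R.lin_indpt S"
    then have "S \<subseteq> carrier V" "V.lin_indpt S" using RV indep by auto
    then show "finite S \<and> card S \<le> V.dim" using V.li_le_dim [OF fin] by blast
  next
    show "{} \<subseteq> carrier (V\<lparr>carrier := R\<rparr>) \<and> R.lin_indpt {}" by (auto simp: R.lin_dep_def)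
  qed
  then obtain A where "finite A"
    and A: "maximal A (\<lambda>S. S \<subseteq> carrier (V\<lparr>carrier := R\<rparr>) \<and> R.lin_indpt S)" by blast
  moreover have "R.gen_set A" by (rule R.max_li_is_gen [OF A])
  moreover have "A \<subseteq> carrier (V\<lparr>carrier := R\<rparr>)" using A by (auto simp: maximal_def)
  ultimately have "R.fin_dim" by (auto simp: R.fin_dim_def)
  then show ?thesis using R.vectorspace_axioms by (simp add: fdvs_def)
qed

section \<open>Direct sums of spaces\<close>

lemma UPair_in_dsum [simp]:
  "UPair x y \<in> carrier (dsum V W) \<longleftrightarrow> x \<in> carrier V \<and> y \<in> carrier W"
  by (simp add: dsum_def)

lemma dsumE:
  assumes "p \<in> carrier (dsum V W)"
  obtains x y where "p = UPair x y" "x \<in> carrier V" "y \<in> carrier W"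
  using assms by (auto simp: dsum_def)

lemma dsum_zero [simp]: "\<zero>\<^bsub>dsum V W\<^esub> = UPair \<zero>\<^bsub>V\<^esub> \<zero>\<^bsub>W\<^esub>"
  and dsum_add [simp]: "p \<oplus>\<^bsub>dsum V W\<^esub> q = UPair (ufst p \<oplus>\<^bsub>V\<^esub> ufst q) (usnd p \<oplus>\<^bsub>W\<^esub> usnd q)"
  and dsum_smult [simp]: "c \<odot>\<^bsub>dsum V W\<^esub> p = UPair (c \<odot>\<^bsub>V\<^esub> ufst p) (c \<odot>\<^bsub>W\<^esub> usnd p)"
  by (simp_all add: dsum_def)

lemma dsum_module:
  assumes "V \<in> fdvs K" "W \<in> fdvs K"
  shows "Module.module K (dsum V W)"
proof (rule module_criteria)
  show "cring K" using fdvs_module [OF assms(1)] by (simp add: Module.module_def)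
  show "\<forall>p\<in>carrier (dsum V W). \<exists>q\<in>carrier (dsum V W). p \<oplus>\<^bsub>dsum V W\<^esub> q = \<zero>\<^bsub>dsum V W\<^esub>"
  proof
    fix p assume "p \<in> carrier (dsum V W)"
    then show "\<exists>q\<in>carrier (dsum V W). p \<oplus>\<^bsub>dsum V W\<^esub> q = \<zero>\<^bsub>dsum V W\<^esub>"
      using assms
      by (intro bexI [where x = "UPair (\<ominus>\<^bsub>V\<^esub> ufst p) (\<ominus>\<^bsub>W\<^esub> usnd p)"]) (auto elim!: dsumE)
  qed
qed (auto elim!: dsumE simp: assms vs_smult_add vs_smult_add_left vs_add_assoc vs_smult_smult
      intro: vs_add_comm [OF assms(1)] vs_add_comm [OF assms(2)])

lemma dsum_fdvs [simp]:
  assumes V: "V \<in> fdvs K" and W: "W \<in> fdvs K"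
  shows "dsum V W \<in> fdvs K"
proof -
  obtain A where A: "finite A" "A \<subseteq> carrier V"
    and genA: "\<And>N. \<lbrakk>submodule K N V; A \<subseteq> N\<rbrakk> \<Longrightarrow> carrier V \<subseteq> N"
    using fdvsE [OF V] by metis
  obtain B where B: "finite B" "B \<subseteq> carrier W"
    and genB: "\<And>N. \<lbrakk>submodule K N W; B \<subseteq> N\<rbrakk> \<Longrightarrow> carrier W \<subseteq> N"
    using fdvsE [OF W] by metis
  let ?C = "(\<lambda>x. UPair x \<zero>\<^bsub>W\<^esub>) ` A \<union> (\<lambda>y. UPair \<zero>\<^bsub>V\<^esub> y) ` B"
  show ?thesis
  proof (rule fdvsI)
    show "Module.module K (dsum V W)" by (rule dsum_module [OF V W])
    show "finite ?C" using A B by simp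
    show "?C \<subseteq> carrier (dsum V W)" using A B V W by auto
    fix N assume N: "submodule K N (dsum V W)" and C: "?C \<subseteq> N"
    interpret submodule K N "dsum V W" by (rule N)
    \<comment> \<open>The preimages of \<open>N\<close> under the two inclusions. They contain
      \<open>A\<close> and \<open>B\<close>, hence are all of \<open>V\<close> and \<open>W\<close>,
      and \<open>(x, y) = (x, 0) + (0, y)\<close> then lies in \<open>N\<close>.\<close>
    let ?N1 = "{x \<in> carrier V. UPair x \<zero>\<^bsub>W\<^esub> \<in> N}" and ?N2 = "{y \<in> carrier W. UPair \<zero>\<^bsub>V\<^esub> y \<in> N}"
    have "submodule K ?N1 V" "submodule K ?N2 W"
      using V W m_closed zero_closed smult_closed
      by (auto simp: submodule_def fdvs_module) (force)+
    then have "carrier V \<subseteq> ?N1" "carrier W \<subseteq> ?N2"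
      using C A B by (intro genA genB; auto)+
    then show "carrier (dsum V W) \<subseteq> N"
    proof (intro subsetI, elim dsumE)
      fix p x y assume p: "p = UPair x y" "x \<in> carrier V" "y \<in> carrier W"
        and "carrier V \<subseteq> ?N1" "carrier W \<subseteq> ?N2"
      then have "UPair x \<zero>\<^bsub>W\<^esub> \<oplus>\<^bsub>dsum V W\<^esub> UPair \<zero>\<^bsub>V\<^esub> y \<in> N" by (intro m_closed) auto
      then show "p \<in> N" using p V W by simp
    qed
  qed
qed

section \<open>Linear maps\<close>

lemma lin_iff:
  "f \<in> lin K V W \<longleftrightarrow> f \<in> extensional (carrier V) \<and> (\<forall>x\<in>carrier V. f x \<in> carrier W) \<and>
    (\<forall>x\<in>carrier V. \<forall>y\<in>carrier V. f (x \<oplus>\<^bsub>V\<^esub> y) = f x \<oplus>\<^bsub>W\<^esub> f y) \<and>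
    (\<forall>c\<in>carrier K. \<forall>x\<in>carrier V. f (c \<odot>\<^bsub>V\<^esub> x) = c \<odot>\<^bsub>W\<^esub> f x)"
  by (auto simp: lin_def LinearCombinations.module_hom_def)

lemma
  assumes "f \<in> lin K V W"
  shows lin_closed: "x \<in> carrier V \<Longrightarrow> f x \<in> carrier W"
    and lin_add: "\<lbrakk>x \<in> carrier V; y \<in> carrier V\<rbrakk> \<Longrightarrow> f (x \<oplus>\<^bsub>V\<^esub> y) = f x \<oplus>\<^bsub>W\<^esub> f y"
    and lin_smult: "\<lbrakk>c \<in> carrier K; x \<in> carrier V\<rbrakk> \<Longrightarrow> f (c \<odot>\<^bsub>V\<^esub> x) = c \<odot>\<^bsub>W\<^esub> f x"
    and lin_undefined: "x \<notin> carrier V \<Longrightarrow> f x = undefined"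
  using assms by (auto simp: lin_iff extensional_def)

lemma lin_zero:
  assumes V: "V \<in> fdvs K" and W: "W \<in> fdvs K" and f: "f \<in> lin K V W"
  shows "f \<zero>\<^bsub>V\<^esub> = \<zero>\<^bsub>W\<^esub>"
proof -
  interpret Module.module K V by (rule fdvs_module [OF V])
  show ?thesis
    using lin_smult [OF f, of "\<zero>\<^bsub>K\<^esub>" "\<zero>\<^bsub>V\<^esub>"] lin_closed [OF f, of "\<zero>\<^bsub>V\<^esub>"] V W by simp
qed

lemma lin_neg:
  assumes V: "V \<in> fdvs K" and W: "W \<in> fdvs K" and f: "f \<in> lin K V W" and x: "x \<in> carrier V"
  shows "f (\<ominus>\<^bsub>V\<^esub> x) = \<ominus>\<^bsub>W\<^esub> f x"
proof -
  interpret field K by (rule field_K)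
  show ?thesis
    using lin_smult [OF f _ x] lin_closed [OF f x] x by (simp add: vs_neg_eq [OF V] vs_neg_eq [OF W])
qed

end

section \<open>Projections, negatives, the zero space and the algebra of linear maps\<close>

definition proj1 :: "('k, 'a) vs \<Rightarrow> ('k, 'a) vs \<Rightarrow> 'a map" where
  "proj1 V W = (\<lambda>p\<in>carrier (dsum V W). ufst p)"

definition proj2 :: "('k, 'a) vs \<Rightarrow> ('k, 'a) vs \<Rightarrow> 'a map" where
  "proj2 V W = (\<lambda>p\<in>carrier (dsum V W). usnd p)"

definition neg_map :: "('k, 'a) vs \<Rightarrow> ('k, 'a) vs \<Rightarrow> 'a map \<Rightarrow> 'a map" where
  "neg_map V W f = (\<lambda>x\<in>carrier V. \<ominus>\<^bsub>W\<^esub> f x)"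

text \<open>The carrier needs a single tree, and \<open>Atom undefined\<close> is one that exists
  for every type of atoms.\<close>

definition zero_vs :: "('k, 'a) vs" where
  "zero_vs = \<lparr>carrier = {Atom undefined}, mult = (\<lambda>_ _. Atom undefined), one = Atom undefined,
    zero = Atom undefined, add = (\<lambda>_ _. Atom undefined), smult = (\<lambda>_ _. Atom undefined)\<rparr>"

lemma id_map_apply [simp]: "x \<in> carrier V \<Longrightarrow> id_map V x = x"
  and add_map_apply [simp]: "x \<in> carrier V \<Longrightarrow> add_map V W f g x = f x \<oplus>\<^bsub>W\<^esub> g x"
  and zero_map_apply [simp]: "x \<in> carrier V \<Longrightarrow> zero_map V W x = \<zero>\<^bsub>W\<^esub>"
  and neg_map_apply [simp]: "x \<in> carrier V \<Longrightarrow> neg_map V W f x = \<ominus>\<^bsub>W\<^esub> f x"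
  and comp_map_apply [simp]: "x \<in> carrier V \<Longrightarrow> comp_map V h f x = h (f x)"
  and incl1_apply [simp]: "x \<in> carrier V \<Longrightarrow> incl1 V W x = UPair x \<zero>\<^bsub>W\<^esub>"
  and incl2_apply [simp]: "y \<in> carrier W \<Longrightarrow> incl2 V W y = UPair \<zero>\<^bsub>V\<^esub> y"
  and proj1_apply [simp]: "p \<in> carrier (dsum V W) \<Longrightarrow> proj1 V W p = ufst p"
  and proj2_apply [simp]: "p \<in> carrier (dsum V W) \<Longrightarrow> proj2 V W p = usnd p"
  and dsum_map_apply [simp]:
    "p \<in> carrier (dsum V W) \<Longrightarrow> dsum_map V W f g p = UPair (f (ufst p)) (g (usnd p))"
  by (simp_all add: id_map_def add_map_def zero_map_def neg_map_def comp_map_def compose_def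
      incl1_def incl2_def proj1_def proj2_def dsum_map_def)

text \<open>Together with \<open>fun_eq_iff\<close> these turn an equation of extensional maps into
  a case split on membership in the carrier, the outside case being
  \<open>undefined = undefined\<close>.\<close>

lemmas map_defs = id_map_def add_map_def zero_map_def neg_map_def comp_map_def compose_def
  incl1_def incl2_def proj1_def proj2_def dsum_map_def restrict_def

lemma map_extensional [simp]:
  "id_map V \<in> extensional (carrier V)"
  "add_map V W f g \<in> extensional (carrier V)"
  "zero_map V W \<in> extensional (carrier V)"
  "neg_map V W f \<in> extensional (carrier V)"
  "comp_map V h f \<in> extensional (carrier V)"
  "incl1 V W \<in> extensional (carrier V)"
  "incl2 V W \<in> extensional (carrier W)"
  "proj1 V W \<in> extensional (carrier (dsum V W))"
  "proj2 V W \<in> extensional (carrier (dsum V W))"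
  "dsum_map V W f g \<in> extensional (carrier (dsum V W))"
  by (simp_all add: id_map_def add_map_def zero_map_def neg_map_def comp_map_def
      incl1_def incl2_def proj1_def proj2_def dsum_map_def)

context ground_field
begin

lemma zero_vs_fdvs [simp]: "zero_vs \<in> fdvs K"
proof (rule fdvsI [where A = "{}"])
  interpret field K by (rule field_K)
  show "Module.module K zero_vs"
    by (rule module_criteria) (auto simp: zero_vs_def is_cring)
  show "carrier zero_vs \<subseteq> N" if "submodule K N zero_vs" for N :: "'a univ set"
    using that by (auto simp: submodule_def zero_vs_def)
qed (auto simp: zero_vs_def)

lemma lin_id [simp]: "V \<in> fdvs K \<Longrightarrow> id_map V \<in> lin K V V"
  by (simp add: lin_iff)

lemma lin_comp [simp]:
  "\<lbrakk>U \<in> fdvs K; f \<in> lin K U V; g \<in> lin K V W\<rbrakk> \<Longrightarrow> comp_map U g f \<in> lin K U W"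
  by (simp add: lin_iff)

lemma lin_zero_map [simp]:
  "\<lbrakk>V \<in> fdvs K; W \<in> fdvs K\<rbrakk> \<Longrightarrow> zero_map V W \<in> lin K V W"
  by (simp add: lin_iff)

lemma lin_add_map [simp]:
  "\<lbrakk>V \<in> fdvs K; W \<in> fdvs K; f \<in> lin K V W; g \<in> lin K V W\<rbrakk> \<Longrightarrow> add_map V W f g \<in> lin K V W"
  by (auto simp: lin_iff vs_smult_add vs_add_assoc vs_add_left_comm)

lemma lin_neg_map [simp]:
  assumes V: "V \<in> fdvs K" and W: "W \<in> fdvs K" and f: "f \<in> lin K V W"
  shows "neg_map V W f \<in> lin K V W"
proof -
  interpret Module.module K W by (rule fdvs_module [OF W])
  show ?thesis
    using V W f by (auto simp: lin_iff vs_neg_eq [OF W] vs_smult_add vs_smult_smult R.m_comm)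
qed

lemma lin_incl [simp]:
  assumes "V \<in> fdvs K" "W \<in> fdvs K"
  shows "incl1 V W \<in> lin K V (dsum V W)" "incl2 V W \<in> lin K W (dsum V W)"
  using assms by (auto simp: lin_iff)

lemma lin_proj [simp]:
  assumes "V \<in> fdvs K" "W \<in> fdvs K"
  shows "proj1 V W \<in> lin K (dsum V W) V" "proj2 V W \<in> lin K (dsum V W) W"
  using assms by (auto simp: lin_iff elim!: dsumE)

lemma lin_dsum_map [simp]:
  assumes "V \<in> fdvs K" "W \<in> fdvs K" "f \<in> lin K V V'" "g \<in> lin K W W'"
  shows "dsum_map V W f g \<in> lin K (dsum V W) (dsum V' W')"
  using assms by (auto simp: lin_iff elim!: dsumE)

text \<open>The hypothesis puts \<open>f x\<close> into \<open>carrier V\<close>, the only place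
  where the extensional composite \<open>comp_map V h g\<close> agrees with applying
  \<open>g\<close> and then \<open>h\<close>.\<close>

lemma comp_assoc:
  assumes "f \<in> lin K U V"
  shows "comp_map U h (comp_map U g f) = comp_map U (comp_map V h g) f"
  using assms by (auto simp: fun_eq_iff map_defs lin_closed)

lemma comp_id_right: "f \<in> lin K V W \<Longrightarrow> comp_map V f (id_map V) = f"
  and comp_id_left: "f \<in> lin K V W \<Longrightarrow> comp_map V (id_map W) f = f"
  by (auto simp: fun_eq_iff map_defs lin_closed lin_undefined)

lemma comp_add_left: 
  assumes "f \<in> lin K U V"
  shows "comp_map U (add_map V W g g') f = add_map U W (comp_map U g f) (comp_map U g' f)"
  using assms by (auto simp: fun_eq_iff map_defs lin_closed)

lemma comp_add_right:
  assumes "f \<in> lin K U V" "f' \<in> lin K U V" "g \<in> lin K V W"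
  shows "comp_map U g (add_map U V f f') = add_map U W (comp_map U g f) (comp_map U g f')"
  using assms by (auto simp: fun_eq_iff map_defs lin_closed lin_add)

lemma
  assumes V: "V \<in> fdvs K" and W: "W \<in> fdvs K" and f: "f \<in> lin K V W"
  shows add_map_zero_left: "add_map V W (zero_map V W) f = f"
    and add_map_neg_left: "add_map V W (neg_map V W f) f = zero_map V W"
    and add_map_comm: "g \<in> lin K V W \<Longrightarrow> add_map V W f g = add_map V W g f"
    and add_map_assoc: "\<lbrakk>g \<in> lin K V W; h \<in> lin K V W\<rbrakk>
      \<Longrightarrow> add_map V W (add_map V W f g) h = add_map V W f (add_map V W g h)"
  using assms
  by (auto simp: fun_eq_iff map_defs lin_closed lin_undefined vs_add_assoc vs_add_comm [OF W])

text \<open>These are the five equations in \<open>biproduct\<close>, proved once for spaces.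
  Representations use them at each vertex and linear relations in each component.\<close>

lemma
  assumes V: "V \<in> fdvs K" and W: "W \<in> fdvs K"
  shows proj1_incl1: "comp_map V (proj1 V W) (incl1 V W) = id_map V"
    and proj2_incl2: "comp_map W (proj2 V W) (incl2 V W) = id_map W"
    and proj2_incl1: "comp_map V (proj2 V W) (incl1 V W) = zero_map V W"
    and proj1_incl2: "comp_map W (proj1 V W) (incl2 V W) = zero_map W V"
    and incl_proj: "add_map (dsum V W) (dsum V W) (comp_map (dsum V W) (incl1 V W) (proj1 V W))
      (comp_map (dsum V W) (incl2 V W) (proj2 V W)) = id_map (dsum V W)"
  using assms by (auto simp: fun_eq_iff map_defs elim!: dsumE)

lemma dsum_map_id: "dsum_map V W (id_map V) (id_map W) = id_map (dsum V W)"
  by (auto simp: fun_eq_iff map_defs elim!: dsumE)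

lemma dsum_map_comp:
  assumes "f \<in> lin K U V" "f' \<in> lin K U' V'"
  shows "dsum_map U U' (comp_map U g f) (comp_map U' g' f')
    = comp_map (dsum U U') (dsum_map V V' g g') (dsum_map U U' f f')"
  using assms by (auto elim!: dsumE simp: fun_eq_iff map_defs lin_closed)

lemma dsum_map_add:
  "dsum_map V V' (add_map V W f g) (add_map V' W' f' g')
    = add_map (dsum V V') (dsum W W') (dsum_map V V' f f') (dsum_map V V' g g')"
  by (auto simp: fun_eq_iff map_defs elim!: dsumE)

text \<open>As a rewrite rule, this equivalence replaces linearity of a map into the zero space by
  an equation, so that existence and uniqueness are settled together.
  \<open>lin_from_zero_vs\<close> does the same for maps out of it, where preservation of zero
  determines the map.\<close>

lemma lin_into_zero_vs:
  assumes V: "V \<in> fdvs K"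
  shows "f \<in> lin K V zero_vs \<longleftrightarrow> f = zero_map V zero_vs"
proof
  assume f: "f \<in> lin K V zero_vs"
  have "f x = \<zero>\<^bsub>zero_vs\<^esub>" if "x \<in> carrier V" for x
    using lin_closed [OF f that] by (simp add: zero_vs_def)
  then show "f = zero_map V zero_vs"
    by (auto simp: fun_eq_iff map_defs lin_undefined [OF f])
next
  assume "f = zero_map V zero_vs"
  then show "f \<in> lin K V zero_vs"
    using V by simp
qed

lemma lin_from_zero_vs:
  assumes V: "V \<in> fdvs K"
  shows "f \<in> lin K zero_vs V \<longleftrightarrow> f = zero_map zero_vs V"
proof
  assume f: "f \<in> lin K zero_vs V"
  have "f x = \<zero>\<^bsub>V\<^esub>" if "x \<in> carrier zero_vs" for x
    using lin_zero [OF zero_vs_fdvs V f] that by (simp add: zero_vs_def)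
  then show "f = zero_map zero_vs V"
    by (auto simp: fun_eq_iff map_defs lin_undefined [OF f])
next
  assume "f = zero_map zero_vs V"
  then show "f \<in> lin K zero_vs V"
    using V by simp
qed

end

section \<open>Representations of a quiver\<close>

lemma rep_cat_simps [simp]:
  "Obj (rep_cat K Q) = rep_obj K Q"
  "carrier (Hom (rep_cat K Q) V W) = rep_mor K Q V W"
  "l \<otimes>\<^bsub>Hom (rep_cat K Q) V W\<^esub> m = (\<lambda>i\<in>verts Q. add_map (vspace V i) (vspace W i) (l i) (m i))"
  "\<one>\<^bsub>Hom (rep_cat K Q) V W\<^esub> = (\<lambda>i\<in>verts Q. zero_map (vspace V i) (vspace W i))"
  "Comp (rep_cat K Q) U V W m l = (\<lambda>i\<in>verts Q. comp_map (vspace U i) (m i) (l i))"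
  "Ident (rep_cat K Q) V = (\<lambda>i\<in>verts Q. id_map (vspace V i))"
  by (simp_all add: rep_cat_def)

text \<open>\<open>'a map\<close> does not mention the scalars, so the type annotation is what ties
  the \<open>zero_vs\<close> inside \<open>vmap\<close> to the field of the representation. The
  restricted lambdas match the extensional families required by \<open>rep_obj\<close>.\<close>

definition zero_rep :: "('v, 'e) pre_digraph \<Rightarrow> ('v, 'e, 'k, 'a) rep" where
  "zero_rep Q = \<lparr>vspace = (\<lambda>i\<in>verts Q. zero_vs),
    vmap = (\<lambda>e\<in>arcs Q. zero_map (zero_vs :: ('k, 'a) vs) zero_vs)\<rparr>"

definition dsum_rep :: "('v, 'e) pre_digraph \<Rightarrow>
  ('v, 'e, 'k, 'a) rep \<Rightarrow> ('v, 'e, 'k, 'a) rep \<Rightarrow> ('v, 'e, 'k, 'a) rep" where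
  "dsum_rep Q X Y =
    \<lparr>vspace = (\<lambda>i\<in>verts Q. dsum (vspace X i) (vspace Y i)),
     vmap = (\<lambda>e\<in>arcs Q. dsum_map (vspace X (tail Q e)) (vspace Y (tail Q e)) (vmap X e) (vmap Y e))\<rparr>"

lemma zero_rep_simps [simp]:
  "i \<in> verts Q \<Longrightarrow> vspace (zero_rep Q) i = zero_vs"
  "e \<in> arcs Q \<Longrightarrow> vmap (zero_rep Q :: ('v, 'e, 'k, 'a) rep) e = zero_map (zero_vs :: ('k, 'a) vs) zero_vs"
  by (simp_all add: zero_rep_def)

lemma dsum_rep_simps [simp]:
  "i \<in> verts Q \<Longrightarrow> vspace (dsum_rep Q X Y) i = dsum (vspace X i) (vspace Y i)"
  "e \<in> arcs Q \<Longrightarrow> vmap (dsum_rep Q X Y) e =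
    dsum_map (vspace X (tail Q e)) (vspace Y (tail Q e)) (vmap X e) (vmap Y e)"
  by (simp_all add: dsum_rep_def)

context ground_field
begin

context
  fixes Q :: "('v, 'e) pre_digraph"
  assumes wf: "wf_digraph Q"
begin

lemma quiver_closed [simp]: "e \<in> arcs Q \<Longrightarrow> tail Q e \<in> verts Q" "e \<in> arcs Q \<Longrightarrow> head Q e \<in> verts Q"
  using wf by (simp_all add: wf_digraph_def)

lemma rep_obj_space [simp]: "\<lbrakk>V \<in> rep_obj K Q; i \<in> verts Q\<rbrakk> \<Longrightarrow> vspace V i \<in> fdvs K"
  and rep_obj_map [simp]:
    "\<lbrakk>V \<in> rep_obj K Q; e \<in> arcs Q\<rbrakk> \<Longrightarrow> vmap V e \<in> lin K (vspace V (tail Q e)) (vspace V (head Q e))"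
  by (auto simp: rep_obj_def)

lemma rep_obj_map_closed [simp]:
  "\<lbrakk>V \<in> rep_obj K Q; e \<in> arcs Q; x \<in> carrier (vspace V (tail Q e))\<rbrakk>
    \<Longrightarrow> vmap V e x \<in> carrier (vspace V (head Q e))"
  using lin_closed [OF rep_obj_map] .

text \<open>Both composites around a square are \<open>undefined\<close> off the carrier, so
  commutation amounts to equations at the vectors of the carrier, which the simplifier can use as
  they stand.\<close>

lemma rep_mor_iff:
  assumes "V \<in> rep_obj K Q" "W \<in> rep_obj K Q"
  shows "l \<in> rep_mor K Q V W \<longleftrightarrow> l \<in> extensional (verts Q) \<and>
    (\<forall>i\<in>verts Q. l i \<in> lin K (vspace V i) (vspace W i)) \<and>
    (\<forall>e\<in>arcs Q. \<forall>x\<in>carrier (vspace V (tail Q e)).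
      l (head Q e) (vmap V e x) = vmap W e (l (tail Q e) x))"
proof -
  have "comp_map U f g = comp_map U f' g' \<longleftrightarrow> (\<forall>x\<in>carrier U. f (g x) = f' (g' x))"
    for U :: "('k, 'a) vs" and f g f' g'
    by (auto simp: fun_eq_iff map_defs)
  then show ?thesis by (auto simp: rep_mor_def PiE_iff)
qed

lemma rep_morI:
  assumes "V \<in> rep_obj K Q" "W \<in> rep_obj K Q"
    and "\<And>i. i \<in> verts Q \<Longrightarrow> l i \<in> lin K (vspace V i) (vspace W i)"
    and "\<And>e x. \<lbrakk>e \<in> arcs Q; x \<in> carrier (vspace V (tail Q e))\<rbrakk>
      \<Longrightarrow> l (head Q e) (vmap V e x) = vmap W e (l (tail Q e) x)"
  shows "restrict l (verts Q) \<in> rep_mor K Q V W"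
  using assms by (simp add: rep_mor_iff)

lemma
  assumes "V \<in> rep_obj K Q" "W \<in> rep_obj K Q" "l \<in> rep_mor K Q V W"
  shows rep_mor_lin: "i \<in> verts Q \<Longrightarrow> l i \<in> lin K (vspace V i) (vspace W i)"
    and rep_mor_natural: "\<lbrakk>e \<in> arcs Q; x \<in> carrier (vspace V (tail Q e))\<rbrakk>
      \<Longrightarrow> l (head Q e) (vmap V e x) = vmap W e (l (tail Q e) x)"
    and rep_mor_extensional: "l \<in> extensional (verts Q)"
  using assms by (auto simp: rep_mor_iff)

lemma rep_mor_eqI:
  assumes "l \<in> extensional (verts Q)" "m \<in> extensional (verts Q)" "\<And>i. i \<in> verts Q \<Longrightarrow> l i = m i"
  shows "l = m"
  using assms by (rule extensionalityI)

section \<open>Category axioms and addition of morphisms of representations\<close>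

lemma rep_cat_category: "category (rep_cat K Q :: ('v, 'e, 'k, 'a) rep_category)"
proof (unfold_locales, unfold rep_cat_simps)
  fix X :: "('v, 'e, 'k, 'a) rep"
  assume "X \<in> rep_obj K Q"
  then show "(\<lambda>i\<in>verts Q. id_map (vspace X i)) \<in> rep_mor K Q X X"
    by (intro rep_morI) auto
next
  fix X Y Z :: "('v, 'e, 'k, 'a) rep" and f g
  assume [simp]: "X \<in> rep_obj K Q" "Y \<in> rep_obj K Q" "Z \<in> rep_obj K Q"
    and f: "f \<in> rep_mor K Q X Y" and g: "g \<in> rep_mor K Q Y Z"
  have [simp]: "g i \<in> lin K (vspace Y i) (vspace Z i)" "f i \<in> lin K (vspace X i) (vspace Y i)"
    if "i \<in> verts Q" for i using that f g by (simp_all add: rep_mor_lin)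
  \<comment> \<open>In \<open>lin_closed\<close> the domain, and in \<open>lin_comp\<close> the
    middle space, occurs in the premises but not in the conclusion, so matching the goal cannot find
    it and it is named here.\<close>
  have [simp]: "f i x \<in> carrier (vspace Y i)" if "i \<in> verts Q" "x \<in> carrier (vspace X i)" for i x
    by (rule lin_closed [where V = "vspace X i"]) (use that in simp_all)
  have [simp]: "comp_map (vspace X i) (g i) (f i) \<in> lin K (vspace X i) (vspace Z i)"
    if "i \<in> verts Q" for i
    by (rule lin_comp [where V = "vspace Y i"]) (use that in simp_all)
  show "(\<lambda>i\<in>verts Q. comp_map (vspace X i) (g i) (f i)) \<in> rep_mor K Q X Z"
    using rep_mor_natural [OF _ _ f] rep_mor_natural [OF _ _ g]
    by (intro rep_morI) simp_all
next
  fix X Y :: "('v, 'e, 'k, 'a) rep" and f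
  assume X: "X \<in> rep_obj K Q" and Y: "Y \<in> rep_obj K Q" and f: "f \<in> rep_mor K Q X Y"
  show "(\<lambda>i\<in>verts Q. comp_map (vspace X i) (f i) ((\<lambda>i\<in>verts Q. id_map (vspace X i)) i)) = f"
    using rep_mor_extensional [OF X Y f]
    by (intro rep_mor_eqI) (simp_all add: comp_id_right [OF rep_mor_lin [OF X Y f]])
  show "(\<lambda>i\<in>verts Q. comp_map (vspace X i) ((\<lambda>i\<in>verts Q. id_map (vspace Y i)) i) (f i)) = f"
    using rep_mor_extensional [OF X Y f]
    by (intro rep_mor_eqI) (simp_all add: comp_id_left [OF rep_mor_lin [OF X Y f]])
next
  fix W X Y Z :: "('v, 'e, 'k, 'a) rep" and f g h
  assume W: "W \<in> rep_obj K Q" and X: "X \<in> rep_obj K Q" and f: "f \<in> rep_mor K Q W X"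
  show "(\<lambda>i\<in>verts Q. comp_map (vspace W i) (h i)
        ((\<lambda>i\<in>verts Q. comp_map (vspace W i) (g i) (f i)) i)) =
      (\<lambda>i\<in>verts Q. comp_map (vspace W i) ((\<lambda>i\<in>verts Q. comp_map (vspace X i) (h i) (g i)) i) (f i))"
    by (intro restrict_ext) (simp add: comp_assoc [OF rep_mor_lin [OF W X f]])
qed

text \<open>The zero family, negatives and sums again commute with the arrows because the structure
  maps of \<open>Y\<close> preserve zero, negatives and sums. The group laws hold
  vertexwise.\<close>

lemma rep_hom_comm_group:
  fixes X Y :: "('v, 'e, 'k, 'a) rep"
  assumes X [simp]: "X \<in> rep_obj K Q" and Y [simp]: "Y \<in> rep_obj K Q"
  shows "comm_group (Hom (rep_cat K Q) X Y)"
proof (rule comm_groupI, unfold rep_cat_simps)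
  note [simp] = rep_mor_lin [OF X Y] rep_mor_natural [OF X Y] rep_mor_extensional [OF X Y]
  have [simp]: "f i x \<in> carrier (vspace Y i)"
    if "f \<in> rep_mor K Q X Y" "i \<in> verts Q" "x \<in> carrier (vspace X i)" for f i x
    using that lin_closed [OF rep_mor_lin [OF X Y]] by blast
  show "(\<lambda>i\<in>verts Q. zero_map (vspace X i) (vspace Y i)) \<in> rep_mor K Q X Y"
    by (intro rep_morI) (auto simp: lin_zero [OF _ _ rep_obj_map])
  fix f assume f [simp]: "f \<in> rep_mor K Q X Y"
  show "(\<lambda>i\<in>verts Q. add_map (vspace X i) (vspace Y i)
      ((\<lambda>i\<in>verts Q. zero_map (vspace X i) (vspace Y i)) i) (f i)) = f"
    by (intro rep_mor_eqI) (auto simp: add_map_zero_left)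
  have "(\<lambda>i\<in>verts Q. neg_map (vspace X i) (vspace Y i) (f i)) \<in> rep_mor K Q X Y"
    by (intro rep_morI) (auto simp: lin_neg [OF _ _ rep_obj_map])
  moreover have "(\<lambda>i\<in>verts Q. add_map (vspace X i) (vspace Y i)
      ((\<lambda>i\<in>verts Q. neg_map (vspace X i) (vspace Y i) (f i)) i) (f i)) =
      (\<lambda>i\<in>verts Q. zero_map (vspace X i) (vspace Y i))"
    by (auto intro!: restrict_ext simp: add_map_neg_left)
  ultimately show "\<exists>g\<in>rep_mor K Q X Y. (\<lambda>i\<in>verts Q. add_map (vspace X i) (vspace Y i) (g i) (f i)) =
      (\<lambda>i\<in>verts Q. zero_map (vspace X i) (vspace Y i))" by blast
  fix g assume g [simp]: "g \<in> rep_mor K Q X Y"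
  show "(\<lambda>i\<in>verts Q. add_map (vspace X i) (vspace Y i) (f i) (g i)) \<in> rep_mor K Q X Y"
    by (intro rep_morI) (auto simp: lin_add [OF rep_obj_map])
  show "(\<lambda>i\<in>verts Q. add_map (vspace X i) (vspace Y i) (f i) (g i)) =
      (\<lambda>i\<in>verts Q. add_map (vspace X i) (vspace Y i) (g i) (f i))"
    by (auto intro!: restrict_ext intro: add_map_comm [OF rep_obj_space rep_obj_space rep_mor_lin])
  fix h assume h [simp]: "h \<in> rep_mor K Q X Y"
  show "(\<lambda>i\<in>verts Q. add_map (vspace X i) (vspace Y i)
        ((\<lambda>i\<in>verts Q. add_map (vspace X i) (vspace Y i) (f i) (g i)) i) (h i)) =
      (\<lambda>i\<in>verts Q. add_map (vspace X i) (vspace Y i) (f i)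
        ((\<lambda>i\<in>verts Q. add_map (vspace X i) (vspace Y i) (g i) (h i)) i))"
    by (auto intro!: restrict_ext simp: add_map_assoc)
qed

lemma rep_cat_preadditive: "preadditive_category (rep_cat K Q :: ('v, 'e, 'k, 'a) rep_category)"
proof (intro preadditive_category.intro preadditive_category_axioms.intro rep_cat_category)
  fix X Y :: "('v, 'e, 'k, 'a) rep"
  assume "X \<in> Obj (rep_cat K Q)" "Y \<in> Obj (rep_cat K Q)"
  then show "comm_group (Hom (rep_cat K Q) X Y)" by (simp add: rep_hom_comm_group)
next
  fix X Y Z :: "('v, 'e, 'k, 'a) rep" and f f' g g'
  assume "X \<in> Obj (rep_cat K Q)" "Y \<in> Obj (rep_cat K Q)" "Z \<in> Obj (rep_cat K Q)"
    and "f \<in> carrier (Hom (rep_cat K Q) X Y)" "g \<in> carrier (Hom (rep_cat K Q) Y Z)"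
  then have X: "X \<in> rep_obj K Q" and Y: "Y \<in> rep_obj K Q" and Z: "Z \<in> rep_obj K Q"
    and f: "f \<in> rep_mor K Q X Y" and g: "g \<in> rep_mor K Q Y Z" by simp_all
  show "Comp (rep_cat K Q) X Y Z (g \<otimes>\<^bsub>Hom (rep_cat K Q) Y Z\<^esub> g') f
      = Comp (rep_cat K Q) X Y Z g f \<otimes>\<^bsub>Hom (rep_cat K Q) X Z\<^esub> Comp (rep_cat K Q) X Y Z g' f"
    unfolding rep_cat_simps
    by (intro restrict_ext) (simp add: comp_add_left [OF rep_mor_lin [OF X Y f]])
  assume "f' \<in> carrier (Hom (rep_cat K Q) X Y)"
  then have f': "f' \<in> rep_mor K Q X Y" by simp
  show "Comp (rep_cat K Q) X Y Z g (f \<otimes>\<^bsub>Hom (rep_cat K Q) X Y\<^esub> f')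
      = Comp (rep_cat K Q) X Y Z g f \<otimes>\<^bsub>Hom (rep_cat K Q) X Z\<^esub> Comp (rep_cat K Q) X Y Z g f'"
    unfolding rep_cat_simps
    by (intro restrict_ext)
      (simp add: comp_add_right [OF rep_mor_lin [OF X Y f] rep_mor_lin [OF X Y f'] rep_mor_lin [OF Y Z g]])
qed

section \<open>Zero object and biproducts of representations\<close>

lemma zero_rep_obj: "zero_rep Q \<in> rep_obj K Q"
  by (auto simp: rep_obj_def zero_rep_def)

lemma dsum_rep_obj: "\<lbrakk>X \<in> rep_obj K Q; Y \<in> rep_obj K Q\<rbrakk> \<Longrightarrow> dsum_rep Q X Y \<in> rep_obj K Q"
  by (auto simp: rep_obj_def dsum_rep_def)

lemma zero_object_zero_rep:
  "zero_object (rep_cat K Q :: ('v, 'e, 'k, 'a) rep_category) (zero_rep Q)"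
proof -
  have Z: "(zero_rep Q :: ('v, 'e, 'k, 'a) rep) \<in> rep_obj K Q" by (rule zero_rep_obj)
  have "\<exists>!f. f \<in> rep_mor K Q X (zero_rep Q)" "\<exists>!f. f \<in> rep_mor K Q (zero_rep Q) X"
    if X: "X \<in> rep_obj K Q" for X :: "('v, 'e, 'k, 'a) rep"
  proof -
    \<comment> \<open>The unit of each hom-group supplies the existence of a morphism; uniqueness is
      then checked vertex by vertex.\<close>
    interpret XZ: comm_group "Hom (rep_cat K Q) X (zero_rep Q)" by (rule rep_hom_comm_group [OF X Z])
    interpret ZX: comm_group "Hom (rep_cat K Q) (zero_rep Q) X" by (rule rep_hom_comm_group [OF Z X])
    have "f = (\<lambda>i\<in>verts Q. zero_map (vspace X i) (vspace (zero_rep Q) i))"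
      if "f \<in> rep_mor K Q X (zero_rep Q)" for f
      using rep_mor_lin [OF X Z that] rep_mor_extensional [OF X Z that] X
      by (intro rep_mor_eqI) (auto simp: lin_into_zero_vs)
    then show "\<exists>!f. f \<in> rep_mor K Q X (zero_rep Q)"
      using XZ.one_closed unfolding rep_cat_simps by blast
    have "f = (\<lambda>i\<in>verts Q. zero_map (vspace (zero_rep Q) i) (vspace X i))"
      if "f \<in> rep_mor K Q (zero_rep Q) X" for f
      using rep_mor_lin [OF Z X that] rep_mor_extensional [OF Z X that] X
      by (intro rep_mor_eqI) (auto simp: lin_from_zero_vs)
    then show "\<exists>!f. f \<in> rep_mor K Q (zero_rep Q) X"
      using ZX.one_closed unfolding rep_cat_simps by blast
  qed
  then show ?thesis using Z by (simp add: zero_object_def)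
qed

lemma biproduct_dsum_rep:
  fixes X Y :: "('v, 'e, 'k, 'a) rep"
  assumes X [simp]: "X \<in> rep_obj K Q" and Y [simp]: "Y \<in> rep_obj K Q"
  shows "biproduct (rep_cat K Q) X Y (dsum_rep Q X Y)
    (\<lambda>i\<in>verts Q. incl1 (vspace X i) (vspace Y i)) (\<lambda>i\<in>verts Q. incl2 (vspace X i) (vspace Y i))
    (\<lambda>i\<in>verts Q. proj1 (vspace X i) (vspace Y i)) (\<lambda>i\<in>verts Q. proj2 (vspace X i) (vspace Y i))"
proof -
  have [simp]: "dsum_rep Q X Y \<in> rep_obj K Q" by (simp add: dsum_rep_obj)
  \<comment> \<open>Naturality of an inclusion asks that the structure map of the other summand send
    the zero coordinate to zero.\<close>
  have [simp]: "vmap V e \<zero>\<^bsub>vspace V (tail Q e)\<^esub> = \<zero>\<^bsub>vspace V (head Q e)\<^esub>"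
    if "V \<in> rep_obj K Q" "e \<in> arcs Q" for e and V :: "('v, 'e, 'k, 'a) rep"
    using that by (simp add: lin_zero [OF _ _ rep_obj_map])
  have "(\<lambda>i\<in>verts Q. incl1 (vspace X i) (vspace Y i)) \<in> rep_mor K Q X (dsum_rep Q X Y)"
    "(\<lambda>i\<in>verts Q. incl2 (vspace X i) (vspace Y i)) \<in> rep_mor K Q Y (dsum_rep Q X Y)"
    "(\<lambda>i\<in>verts Q. proj1 (vspace X i) (vspace Y i)) \<in> rep_mor K Q (dsum_rep Q X Y) X"
    "(\<lambda>i\<in>verts Q. proj2 (vspace X i) (vspace Y i)) \<in> rep_mor K Q (dsum_rep Q X Y) Y"
    by (intro rep_morI; auto elim!: dsumE)+
  then show ?thesis
    by (auto simp: biproduct_def intro!: restrict_ext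
        simp: proj1_incl1 proj2_incl2 proj1_incl2 proj2_incl1 incl_proj)
qed

theorem rep_cat_additive:
  "additive_category (rep_cat K Q :: ('v, 'e, 'k, 'a) rep_category)"
proof (rule additive_category.intro [OF rep_cat_preadditive], unfold_locales)
  show "\<exists>Z :: ('v, 'e, 'k, 'a) rep. zero_object (rep_cat K Q) Z"
    using zero_object_zero_rep by blast
  fix X Y :: "('v, 'e, 'k, 'a) rep"
  assume "X \<in> Obj (rep_cat K Q)" "Y \<in> Obj (rep_cat K Q)"
  then show "\<exists>P i1 i2 p1 p2. biproduct (rep_cat K Q) X Y P i1 i2 p1 p2"
    using biproduct_dsum_rep by fastforce
qed

end

end

section \<open>Linear relations\<close>

text \<open>Two maps are allowed so that one set of lemmas serves both categories of relations:
  \<open>lrel_cat\<close> takes \<open>l = m\<close>, and \<open>lrel2_cat\<close> takes its pair of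
  maps for each of the two relations.\<close>

definition rel_map :: "'a univ set \<Rightarrow> 'a univ set \<Rightarrow> 'a map \<Rightarrow> 'a map \<Rightarrow> bool" where
  "rel_map R S l m \<longleftrightarrow> (\<forall>x y. UPair x y \<in> R \<longrightarrow> UPair (l x) (m y) \<in> S)"

text \<open>The direct sum of the relations with the two middle coordinates exchanged:
  \<open>R \<oplus> S\<close> lies in \<open>(V \<oplus> W) \<oplus> (V' \<oplus> W')\<close>,
  whereas a relation between \<open>V \<oplus> V'\<close> and \<open>W \<oplus> W'\<close> has to
  lie in \<open>(V \<oplus> V') \<oplus> (W \<oplus> W')\<close>.\<close>

definition dsum_rel :: "'a univ set \<Rightarrow> 'a univ set \<Rightarrow> 'a univ set" where
  "dsum_rel R S = {UPair (UPair x x') (UPair y y') | x x' y y'. UPair x y \<in> R \<and> UPair x' y' \<in> S}"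

lemma UPair_in_dsum_rel [simp]:
  "UPair (UPair x x') (UPair y y') \<in> dsum_rel R S \<longleftrightarrow> UPair x y \<in> R \<and> UPair x' y' \<in> S"
  by (auto simp: dsum_rel_def)

lemma dsum_relE:
  assumes "UPair p q \<in> dsum_rel R S"
  obtains x x' y y' where "p = UPair x x'" "q = UPair y y'" "UPair x y \<in> R" "UPair x' y' \<in> S"
  using assms by (auto simp: dsum_rel_def)

text \<open>The preservation condition is folded into the constant \<open>rel_map\<close>, so that
  automation closes it with the rules in \<open>rel_map_intros\<close> instead of splitting its
  quantifiers.\<close>

lemma lrel_cat_simps [simp]:
  "(V, R) \<in> Obj (lrel_cat K) \<longleftrightarrow> V \<in> fdvs K \<and> VectorSpace.subspace K R (dsum V V)"
  "l \<in> carrier (Hom (lrel_cat K) (V, R) (W, S)) \<longleftrightarrow> l \<in> lin K V W \<and> rel_map R S l l"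
  "l \<otimes>\<^bsub>Hom (lrel_cat K) (V, R) (W, S)\<^esub> m = add_map V W l m"
  "\<one>\<^bsub>Hom (lrel_cat K) (V, R) (W, S)\<^esub> = zero_map V W"
  "Comp (lrel_cat K) (V, R) Y Z m l = comp_map V m l"
  "Ident (lrel_cat K) (V, R) = id_map V"
  by (auto simp: lrel_cat_def rel_map_def split: prod.split)

lemma lrel2_cat_simps [simp]:
  "(V1, V2, R1, R2) \<in> Obj (lrel2_cat K) \<longleftrightarrow> V1 \<in> fdvs K \<and> V2 \<in> fdvs K \<and>
    VectorSpace.subspace K R1 (dsum V1 V2) \<and> VectorSpace.subspace K R2 (dsum V1 V2)"
  "(l1, l2) \<in> carrier (Hom (lrel2_cat K) (V1, V2, R1, R2) (W1, W2, S1, S2)) \<longleftrightarrow>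
    l1 \<in> lin K V1 W1 \<and> l2 \<in> lin K V2 W2 \<and> rel_map R1 S1 l1 l2 \<and> rel_map R2 S2 l1 l2"
  "(l1, l2) \<otimes>\<^bsub>Hom (lrel2_cat K) (V1, V2, R1, R2) (W1, W2, S1, S2)\<^esub> (m1, m2)
    = (add_map V1 W1 l1 m1, add_map V2 W2 l2 m2)"
  "\<one>\<^bsub>Hom (lrel2_cat K) (V1, V2, R1, R2) (W1, W2, S1, S2)\<^esub> = (zero_map V1 W1, zero_map V2 W2)"
  "Comp (lrel2_cat K) (V1, V2, R1, R2) Y Z (m1, m2) (l1, l2) = (comp_map V1 m1 l1, comp_map V2 m2 l2)"
  "Ident (lrel2_cat K) (V1, V2, R1, R2) = (id_map V1, id_map V2)"
  by (auto simp: lrel2_cat_def rel_map_def)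

context ground_field
begin

lemma subspace_relI:
  assumes "V \<in> fdvs K" "W \<in> fdvs K" "R \<subseteq> carrier (dsum V W)" "UPair \<zero>\<^bsub>V\<^esub> \<zero>\<^bsub>W\<^esub> \<in> R"
    and "\<And>x y x' y'. \<lbrakk>UPair x y \<in> R; UPair x' y' \<in> R\<rbrakk> \<Longrightarrow> UPair (x \<oplus>\<^bsub>V\<^esub> x') (y \<oplus>\<^bsub>W\<^esub> y') \<in> R"
    and "\<And>c x y. \<lbrakk>c \<in> carrier K; UPair x y \<in> R\<rbrakk> \<Longrightarrow> UPair (c \<odot>\<^bsub>V\<^esub> x) (c \<odot>\<^bsub>W\<^esub> y) \<in> R"
  shows "VectorSpace.subspace K R (dsum V W)"
proof -
  have "submodule K R (dsum V W)"
  proof (rule submodule.intro)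
    show "\<zero>\<^bsub>dsum V W\<^esub> \<in> R" using assms by simp
    fix p assume "p \<in> R"
    then obtain x y where p: "p = UPair x y" "UPair x y \<in> R" using assms(3) by (blast elim!: dsumE)
    show "c \<odot>\<^bsub>dsum V W\<^esub> p \<in> R" if "c \<in> carrier K" for c using that p assms(6) by simp
    fix q assume "q \<in> R"
    then obtain x' y' where "q = UPair x' y'" "UPair x' y' \<in> R" using assms(3) by (blast elim!: dsumE)
    with p show "p \<oplus>\<^bsub>dsum V W\<^esub> q \<in> R" using assms(5) by simp
  qed (simp_all add: assms dsum_module)
  then show ?thesis using assms by (simp add: VectorSpace.subspace_def fdvs_vectorspace)
qed

lemma
  assumes "VectorSpace.subspace K R (dsum V W)"
  shows subspace_rel_closed: "UPair x y \<in> R \<Longrightarrow> x \<in> carrier V \<and> y \<in> carrier W"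
    and subspace_rel_zero: "UPair \<zero>\<^bsub>V\<^esub> \<zero>\<^bsub>W\<^esub> \<in> R"
    and subspace_rel_add:
      "\<lbrakk>UPair x y \<in> R; UPair x' y' \<in> R\<rbrakk> \<Longrightarrow> UPair (x \<oplus>\<^bsub>V\<^esub> x') (y \<oplus>\<^bsub>W\<^esub> y') \<in> R"
    and subspace_rel_smult:
      "\<lbrakk>c \<in> carrier K; UPair x y \<in> R\<rbrakk> \<Longrightarrow> UPair (c \<odot>\<^bsub>V\<^esub> x) (c \<odot>\<^bsub>W\<^esub> y) \<in> R"
proof -
  interpret submodule K R "dsum V W" using assms by (simp add: VectorSpace.subspace_def)
  show "UPair x y \<in> R \<Longrightarrow> x \<in> carrier V \<and> y \<in> carrier W" using subset by auto
  show "UPair \<zero>\<^bsub>V\<^esub> \<zero>\<^bsub>W\<^esub> \<in> R" using zero_closed by simp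
  show "\<lbrakk>UPair x y \<in> R; UPair x' y' \<in> R\<rbrakk> \<Longrightarrow> UPair (x \<oplus>\<^bsub>V\<^esub> x') (y \<oplus>\<^bsub>W\<^esub> y') \<in> R"
    using m_closed [of "UPair x y" "UPair x' y'"] by simp
  show "\<lbrakk>c \<in> carrier K; UPair x y \<in> R\<rbrakk> \<Longrightarrow> UPair (c \<odot>\<^bsub>V\<^esub> x) (c \<odot>\<^bsub>W\<^esub> y) \<in> R"
    using smult_closed [of c "UPair x y"] by simp
qed

lemma subspace_dsum_rel:
  assumes V: "V \<in> fdvs K" "W \<in> fdvs K" "V' \<in> fdvs K" "W' \<in> fdvs K"
    and R: "VectorSpace.subspace K R (dsum V W)" and S: "VectorSpace.subspace K S (dsum V' W')"
  shows "VectorSpace.subspace K (dsum_rel R S) (dsum (dsum V V') (dsum W W'))"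
  using V subspace_rel_closed [OF R] subspace_rel_closed [OF S]
  by (intro subspace_relI)
    (auto simp: dsum_rel_def intro: subspace_rel_zero [OF R] subspace_rel_zero [OF S]
      subspace_rel_add [OF R] subspace_rel_add [OF S] subspace_rel_smult [OF R] subspace_rel_smult [OF S])

lemma subspace_zero_rel:
  "VectorSpace.subspace K {UPair (Atom undefined) (Atom undefined)} (dsum zero_vs zero_vs)"
  \<comment> \<open>The first two goals are \<open>zero_vs \<in> fdvs K\<close>; they are closed
    before \<open>zero_vs_def\<close> unfolds the constant that \<open>zero_vs_fdvs\<close>
    matches.\<close>
  by (rule subspace_relI) (simp, simp, simp_all add: zero_vs_def)

lemma rel_map_id:
  assumes "VectorSpace.subspace K R (dsum V W)"
  shows "rel_map R R (id_map V) (id_map W)"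
  using subspace_rel_closed [OF assms] by (auto simp: rel_map_def)

lemma rel_map_comp:
  assumes "VectorSpace.subspace K R (dsum V W)" "rel_map R S l m" "rel_map S T l' m'"
  shows "rel_map R T (comp_map V l' l) (comp_map W m' m)"
  using assms(2,3) subspace_rel_closed [OF assms(1)] by (auto simp: rel_map_def)

lemma rel_map_zero:
  assumes "VectorSpace.subspace K R (dsum V W)" "VectorSpace.subspace K S (dsum V' W')"
  shows "rel_map R S (zero_map V V') (zero_map W W')"
  using subspace_rel_closed [OF assms(1)] subspace_rel_zero [OF assms(2)] by (auto simp: rel_map_def)

lemma rel_map_add:
  assumes "VectorSpace.subspace K R (dsum V W)" "VectorSpace.subspace K S (dsum V' W')"
    and "rel_map R S l m" "rel_map R S l' m'"
  shows "rel_map R S (add_map V V' l l') (add_map W W' m m')"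
  using subspace_rel_closed [OF assms(1)] subspace_rel_add [OF assms(2)] assms(3,4)
  by (auto simp: rel_map_def)

lemma rel_map_neg:
  assumes "VectorSpace.subspace K R (dsum V W)" "VectorSpace.subspace K S (dsum V' W')"
    and "V' \<in> fdvs K" "W' \<in> fdvs K" "rel_map R S l m"
  shows "rel_map R S (neg_map V V' l) (neg_map W W' m)"
proof -
  interpret field K by (rule field_K)
  have "UPair (\<ominus>\<^bsub>V'\<^esub> l x) (\<ominus>\<^bsub>W'\<^esub> m y) \<in> S" if "UPair x y \<in> R" for x y
  proof -
    from that assms(5) have lm: "UPair (l x) (m y) \<in> S" by (simp add: rel_map_def)
    then have "l x \<in> carrier V'" "m y \<in> carrier W'" using subspace_rel_closed [OF assms(2)] by auto
    \<comment> \<open>A negative is the multiple by minus one, and a subspace is closed under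
      scalars.\<close>
    with lm show ?thesis
      using subspace_rel_smult [OF assms(2), of "\<ominus>\<^bsub>K\<^esub> \<one>\<^bsub>K\<^esub>"]
      by (simp add: vs_neg_eq [OF assms(3)] vs_neg_eq [OF assms(4)])
  qed
  then show ?thesis
    using subspace_rel_closed [OF assms(1)] by (simp add: rel_map_def)
qed

text \<open>The inclusions preserve the relations because the other summand contains the pair of
  zeros.\<close>

lemma
  assumes R: "VectorSpace.subspace K R (dsum V W)" and S: "VectorSpace.subspace K S (dsum V' W')"
  shows rel_map_incl1: "rel_map R (dsum_rel R S) (incl1 V V') (incl1 W W')"
    and rel_map_incl2: "rel_map S (dsum_rel R S) (incl2 V V') (incl2 W W')"
    and rel_map_proj1: "rel_map (dsum_rel R S) R (proj1 V V') (proj1 W W')"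
    and rel_map_proj2: "rel_map (dsum_rel R S) S (proj2 V V') (proj2 W W')"
  using subspace_rel_closed [OF R] subspace_rel_closed [OF S]
    subspace_rel_zero [OF R] subspace_rel_zero [OF S]
  by (auto simp: rel_map_def elim!: dsum_relE)

lemmas rel_map_intros = rel_map_id rel_map_comp rel_map_zero rel_map_add rel_map_neg
  rel_map_incl1 rel_map_incl2 rel_map_proj1 rel_map_proj2

section \<open>Additivity of lrel(k)\<close>

lemma lrel_cat_category: "category (lrel_cat K :: (('k, 'a) lrel_object, 'a map) cat)"
  by unfold_locales
    (auto simp: comp_id_left comp_id_right comp_assoc intro: lin_comp rel_map_intros)

lemma lrel_hom_comm_group:
  fixes X Y :: "('k, 'a) lrel_object"
  assumes "X \<in> Obj (lrel_cat K)" "Y \<in> Obj (lrel_cat K)"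
  shows "comm_group (Hom (lrel_cat K) X Y)"
proof -
  obtain V R W S where XY: "X = (V, R)" "Y = (W, S)" by (metis surj_pair)
  show ?thesis
    using assms unfolding XY
    \<comment> \<open>The inverse of a morphism is its pointwise negative. The map under
      \<open>neg_map\<close> stays schematic in the witness and is found when
      \<open>add_map_neg_left\<close> is applied.\<close>
    by (intro comm_groupI)
      (auto simp: add_map_zero_left add_map_assoc intro: add_map_comm rel_map_intros
        intro!: bexI [where x = "neg_map V W f" for f] add_map_neg_left)
qed

lemma lrel_cat_preadditive: "preadditive_category (lrel_cat K :: (('k, 'a) lrel_object, 'a map) cat)"
  by (intro preadditive_category.intro preadditive_category_axioms.intro lrel_cat_category
      lrel_hom_comm_group)
    (auto intro: comp_add_left comp_add_right)

lemma zero_object_lrel: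
  "zero_object (lrel_cat K :: (('k, 'a) lrel_object, 'a map) cat)
    (zero_vs, {UPair (Atom undefined) (Atom undefined)})"
  by (auto simp: zero_object_def subspace_zero_rel lin_into_zero_vs lin_from_zero_vs
      intro!: ex1I rel_map_zero)

lemma biproduct_lrel:
  assumes "(V, R) \<in> Obj (lrel_cat K)" "(W, S) \<in> Obj (lrel_cat K)"
  shows "biproduct (lrel_cat K) (V, R) (W, S) (dsum V W, dsum_rel R S)
    (incl1 V W) (incl2 V W) (proj1 V W) (proj2 V W)"
  using assms
  by (auto simp: biproduct_def subspace_dsum_rel proj1_incl1 proj2_incl2 proj1_incl2 proj2_incl1
      incl_proj intro: rel_map_intros)

theorem lrel_cat_additive: "additive_category (lrel_cat K :: (('k, 'a) lrel_object, 'a map) cat)"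
proof (intro additive_category.intro additive_category_axioms.intro lrel_cat_preadditive)
  show "\<exists>Z :: ('k, 'a) lrel_object. zero_object (lrel_cat K) Z" using zero_object_lrel by blast
  fix X Y :: "('k, 'a) lrel_object"
  assume "X \<in> Obj (lrel_cat K)" "Y \<in> Obj (lrel_cat K)"
  then show "\<exists>P i1 i2 p1 p2. biproduct (lrel_cat K) X Y P i1 i2 p1 p2"
    using biproduct_lrel by (cases X, cases Y) blast
qed

section \<open>Additivity of lrel^2_2(k)\<close>

lemma lrel2_cat_category:
  "category (lrel2_cat K :: (('k, 'a) lrel2_object, 'a map \<times> 'a map) cat)"
  by unfold_locales
    (auto simp: comp_id_left comp_id_right comp_assoc intro: lin_comp rel_map_intros)

lemma lrel2_hom_comm_group:
  fixes X Y :: "('k, 'a) lrel2_object"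
  assumes "X \<in> Obj (lrel2_cat K)" "Y \<in> Obj (lrel2_cat K)"
  shows "comm_group (Hom (lrel2_cat K) X Y)"
proof -
  obtain V1 V2 R1 R2 where X: "X = (V1, V2, R1, R2)" by (metis surj_pair)
  obtain W1 W2 S1 S2 where Y: "Y = (W1, W2, S1, S2)" by (metis surj_pair)
  show ?thesis
    using assms unfolding X Y
    by (intro comm_groupI)
      (auto simp: add_map_zero_left add_map_assoc intro: add_map_comm rel_map_intros
        intro!: bexI [where x = "(neg_map V1 W1 f, neg_map V2 W2 g)" for f g] add_map_neg_left)
qed

lemma lrel2_cat_preadditive:
  "preadditive_category (lrel2_cat K :: (('k, 'a) lrel2_object, 'a map \<times> 'a map) cat)"
  by (intro preadditive_category.intro preadditive_category_axioms.intro lrel2_cat_category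
      lrel2_hom_comm_group)
    (auto intro: comp_add_left comp_add_right)

lemma zero_object_lrel2:
  "zero_object (lrel2_cat K :: (('k, 'a) lrel2_object, 'a map \<times> 'a map) cat)
    (zero_vs, zero_vs, {UPair (Atom undefined) (Atom undefined)},
      {UPair (Atom undefined) (Atom undefined)})"
  by (auto simp: zero_object_def subspace_zero_rel lin_into_zero_vs lin_from_zero_vs
      intro!: ex1I rel_map_zero)

lemma biproduct_lrel2:
  assumes "(V1, V2, R1, R2) \<in> Obj (lrel2_cat K)" "(W1, W2, S1, S2) \<in> Obj (lrel2_cat K)"
  shows "biproduct (lrel2_cat K) (V1, V2, R1, R2) (W1, W2, S1, S2)
    (dsum V1 W1, dsum V2 W2, dsum_rel R1 S1, dsum_rel R2 S2)
    (incl1 V1 W1, incl1 V2 W2) (incl2 V1 W1, incl2 V2 W2)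
    (proj1 V1 W1, proj1 V2 W2) (proj2 V1 W1, proj2 V2 W2)"
  using assms
  by (auto simp: biproduct_def subspace_dsum_rel proj1_incl1 proj2_incl2 proj1_incl2 proj2_incl1
      incl_proj intro: rel_map_intros)

theorem lrel2_cat_additive:
  "additive_category (lrel2_cat K :: (('k, 'a) lrel2_object, 'a map \<times> 'a map) cat)"
proof (intro additive_category.intro additive_category_axioms.intro lrel2_cat_preadditive)
  show "\<exists>Z :: ('k, 'a) lrel2_object. zero_object (lrel2_cat K) Z" using zero_object_lrel2 by blast
  fix X Y :: "('k, 'a) lrel2_object"
  assume X: "X \<in> Obj (lrel2_cat K)" and Y: "Y \<in> Obj (lrel2_cat K)"
  obtain V1 V2 R1 R2 where "X = (V1, V2, R1, R2)" by (metis surj_pair)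
  moreover obtain W1 W2 S1 S2 where "Y = (W1, W2, S1, S2)" by (metis surj_pair)
  ultimately show "\<exists>P i1 i2 p1 p2. biproduct (lrel2_cat K) X Y P i1 i2 p1 p2"
    using biproduct_lrel2 X Y by blast
qed

end

section \<open>The functors\<close>

lemma wf_quiver_F: "wf_digraph quiver_F"
  and wf_quiver_S: "wf_digraph quiver_S"
  and wf_quiver_D: "wf_digraph quiver_D"
  and wf_quiver_K: "wf_digraph quiver_K"
  and wf_quiver_C: "wf_digraph quiver_C"
  by (unfold_locales; auto simp: quiver_F_def quiver_S_def quiver_D_def quiver_K_def quiver_C_def)+

lemma quiver_simps:
  "verts quiver_S = {1, 2, 3, 4}" "arcs quiver_S = {Alpha, Beta, Gamma, Delta}"
  "tail quiver_S Alpha = 3" "tail quiver_S Beta = 3" "tail quiver_S Gamma = 4" "tail quiver_S Delta = 4"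
  "head quiver_S Alpha = 1" "head quiver_S Beta = 2" "head quiver_S Gamma = 1" "head quiver_S Delta = 2"
  "verts quiver_D = {1, 2, 3}" "arcs quiver_D = {Alpha, Beta, Gamma}"
  "tail quiver_D Alpha = 3" "tail quiver_D Beta = 3" "tail quiver_D Gamma = 2"
  "head quiver_D Alpha = 1" "head quiver_D Beta = 2" "head quiver_D Gamma = 1"
  "verts quiver_K = {1, 2}" "arcs quiver_K = {Alpha, Beta}"
  "tail quiver_K Alpha = 2" "tail quiver_K Beta = 2"
  "head quiver_K Alpha = 1" "head quiver_K Beta = 1"
  "verts quiver_C = {1, 2}" "arcs quiver_C = {Alpha, Beta}"
  "tail quiver_C Alpha = 2" "tail quiver_C Beta = 1"
  "head quiver_C Alpha = 1" "head quiver_C Beta = 2"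
  by (simp_all add: quiver_F_def quiver_S_def quiver_D_def quiver_K_def quiver_C_def)

lemma F_rep_simps [simp]:
  "vspace (F_rep V0 V1 V2 V3 V4 fa fb fc fd) 0 = V0"
  "vspace (F_rep V0 V1 V2 V3 V4 fa fb fc fd) 1 = V1"
  "vspace (F_rep V0 V1 V2 V3 V4 fa fb fc fd) 2 = V2"
  "vspace (F_rep V0 V1 V2 V3 V4 fa fb fc fd) 3 = V3"
  "vspace (F_rep V0 V1 V2 V3 V4 fa fb fc fd) 4 = V4"
  "vmap (F_rep V0 V1 V2 V3 V4 fa fb fc fd) Alpha = fa"
  "vmap (F_rep V0 V1 V2 V3 V4 fa fb fc fd) Beta = fb"
  "vmap (F_rep V0 V1 V2 V3 V4 fa fb fc fd) Gamma = fc"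
  "vmap (F_rep V0 V1 V2 V3 V4 fa fb fc fd) Delta = fd"
  by (simp_all add: F_rep_def)

lemma F_mor_simps [simp]:
  "F_mor l0 l1 l2 l3 l4 0 = l0"
  "F_mor l0 l1 l2 l3 l4 1 = l1"
  "F_mor l0 l1 l2 l3 l4 2 = l2"
  "F_mor l0 l1 l2 l3 l4 3 = l3"
  "F_mor l0 l1 l2 l3 l4 4 = l4"
  by (simp_all add: F_mor_def)

lemma F_mor_extensional: "F_mor l0 l1 l2 l3 l4 \<in> extensional (verts quiver_F)"
  by (simp add: F_mor_def quiver_F_def extensional_def)

context ground_field
begin

section \<open>Criteria for objects and for additive functors into representations\<close>

lemma F_rep_obj_iff:
  "F_rep V0 V1 V2 V3 V4 fa fb fc fd \<in> rep_obj K quiver_F \<longleftrightarrow>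
    V0 \<in> fdvs K \<and> V1 \<in> fdvs K \<and> V2 \<in> fdvs K \<and> V3 \<in> fdvs K \<and> V4 \<in> fdvs K \<and>
    fa \<in> lin K V1 V0 \<and> fb \<in> lin K V2 V0 \<and> fc \<in> lin K V3 V0 \<and> fd \<in> lin K V4 V0"
  by (auto simp: rep_obj_def PiE_iff extensional_def quiver_F_def F_rep_def)

text \<open>A morphism of representations is an extensional family, so each functor law reduces to
  an equation at a single vertex. The left sides are extensional by \<open>mor\<close>, the right
  sides by the restricted lambdas in \<open>rep_cat\<close>.\<close>

lemma additive_functor_repI:
  assumes wf: "wf_digraph Q" and C: "additive_category C"
    and obj: "\<And>X. X \<in> Obj C \<Longrightarrow> on_obj F X \<in> rep_obj K Q"
    and mor: "\<And>X Y f. \<lbrakk>X \<in> Obj C; Y \<in> Obj C; f \<in> carrier (Hom C X Y)\<rbrakk>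
      \<Longrightarrow> on_hom F X Y f \<in> rep_mor K Q (on_obj F X) (on_obj F Y)"
    and ident: "\<And>X i. \<lbrakk>X \<in> Obj C; i \<in> verts Q\<rbrakk>
      \<Longrightarrow> on_hom F X X (Ident C X) i = id_map (vspace (on_obj F X) i)"
    and comp: "\<And>X Y Z f g i. \<lbrakk>X \<in> Obj C; Y \<in> Obj C; Z \<in> Obj C;
        f \<in> carrier (Hom C X Y); g \<in> carrier (Hom C Y Z); i \<in> verts Q\<rbrakk>
      \<Longrightarrow> on_hom F X Z (Comp C X Y Z g f) i
        = comp_map (vspace (on_obj F X) i) (on_hom F Y Z g i) (on_hom F X Y f i)"
    and add: "\<And>X Y f g i. \<lbrakk>X \<in> Obj C; Y \<in> Obj C;
        f \<in> carrier (Hom C X Y); g \<in> carrier (Hom C X Y); i \<in> verts Q\<rbrakk>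
      \<Longrightarrow> on_hom F X Y (f \<otimes>\<^bsub>Hom C X Y\<^esub> g) i
        = add_map (vspace (on_obj F X) i) (vspace (on_obj F Y) i) (on_hom F X Y f i) (on_hom F X Y g i)"
  shows "additive_functor C (rep_cat K Q) F"
proof -
  interpret C: additive_category C by (rule C)
  interpret D: additive_category "rep_cat K Q" by (rule rep_cat_additive [OF wf])
  have ext: "on_hom F X Y f \<in> extensional (verts Q)"
    if "X \<in> Obj C" "Y \<in> Obj C" "f \<in> carrier (Hom C X Y)" for X Y f
    using rep_mor_extensional [OF wf obj obj mor] that by blast
  have hom_group: "comm_group (Hom C X Y)" if "X \<in> Obj C" "Y \<in> Obj C" for X Y
    using that by (rule C.hom_comm_group)
  show ?thesis
  proof (intro additive_functor.intro cat_functor.intro cat_functor_axioms.intro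
      additive_functor_axioms.intro C.category_axioms D.category_axioms
      C.additive_category_axioms D.additive_category_axioms)
    show "on_obj F X \<in> Obj (rep_cat K Q)" if "X \<in> Obj C" for X
      using that by (simp add: obj)
    show "on_hom F X Y f \<in> carrier (Hom (rep_cat K Q) (on_obj F X) (on_obj F Y))"
      if "X \<in> Obj C" "Y \<in> Obj C" "f \<in> carrier (Hom C X Y)" for X Y f
      using that by (simp add: mor)
    show "on_hom F X X (Ident C X) = Ident (rep_cat K Q) (on_obj F X)" if "X \<in> Obj C" for X
      using that ext [OF that that C.ident_closed]
      by (intro extensionalityI [where A = "verts Q"]) (simp_all add: ident)
    show "on_hom F X Z (Comp C X Y Z g f) =
        Comp (rep_cat K Q) (on_obj F X) (on_obj F Y) (on_obj F Z) (on_hom F Y Z g) (on_hom F X Y f)"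
      if "X \<in> Obj C" "Y \<in> Obj C" "Z \<in> Obj C" "f \<in> carrier (Hom C X Y)" "g \<in> carrier (Hom C Y Z)"
      for X Y Z f g
      using that ext [OF that(1,3) C.comp_closed]
      by (intro extensionalityI [where A = "verts Q"]) (simp_all add: comp)
    show "on_hom F X Y \<in> hom (Hom C X Y) (Hom (rep_cat K Q) (on_obj F X) (on_obj F Y))"
      if "X \<in> Obj C" "Y \<in> Obj C" for X Y
    proof (rule homI)
      interpret comm_group "Hom C X Y" using that by (rule hom_group)
      show "on_hom F X Y f \<in> carrier (Hom (rep_cat K Q) (on_obj F X) (on_obj F Y))"
        if "f \<in> carrier (Hom C X Y)" for f
        using that \<open>X \<in> Obj C\<close> \<open>Y \<in> Obj C\<close> by (simp add: mor)
      show "on_hom F X Y (f \<otimes>\<^bsub>Hom C X Y\<^esub> g) =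
          on_hom F X Y f \<otimes>\<^bsub>Hom (rep_cat K Q) (on_obj F X) (on_obj F Y)\<^esub> on_hom F X Y g"
        if "f \<in> carrier (Hom C X Y)" "g \<in> carrier (Hom C X Y)" for f g
        using that \<open>X \<in> Obj C\<close> \<open>Y \<in> Obj C\<close> ext [OF \<open>X \<in> Obj C\<close> \<open>Y \<in> Obj C\<close> m_closed]
        by (intro extensionalityI [where A = "verts Q"]) (simp_all add: add)
    qed
  qed
qed

text \<open>Vertex 0 and the arrows \<open>Alpha\<close> and \<open>Beta\<close> are treated here
  once for all six functors. The laws at vertex 0 follow from those at vertices 1 and 2 by
  \<open>dsum_map_id\<close>, \<open>dsum_map_comp\<close> and \<open>dsum_map_add\<close>, so a
  particular functor supplies the laws at vertices 1 to 4 and its two remaining squares.\<close>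

lemma additive_functor_quiver_FI:
  assumes C: "additive_category C"
    and obj: "\<And>X. X \<in> Obj C \<Longrightarrow> on_obj F X \<in> rep_obj K quiver_F"
    and space0: "\<And>X. X \<in> Obj C
      \<Longrightarrow> vspace (on_obj F X) 0 = dsum (vspace (on_obj F X) 1) (vspace (on_obj F X) 2)"
    and alpha: "\<And>X. X \<in> Obj C
      \<Longrightarrow> vmap (on_obj F X) Alpha = incl1 (vspace (on_obj F X) 1) (vspace (on_obj F X) 2)"
    and beta: "\<And>X. X \<in> Obj C
      \<Longrightarrow> vmap (on_obj F X) Beta = incl2 (vspace (on_obj F X) 1) (vspace (on_obj F X) 2)"
    and hom_ext: "\<And>X Y f. \<lbrakk>X \<in> Obj C; Y \<in> Obj C; f \<in> carrier (Hom C X Y)\<rbrakk>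
      \<Longrightarrow> on_hom F X Y f \<in> extensional (verts quiver_F)"
    and hom0: "\<And>X Y f. \<lbrakk>X \<in> Obj C; Y \<in> Obj C; f \<in> carrier (Hom C X Y)\<rbrakk>
      \<Longrightarrow> on_hom F X Y f 0 = dsum_map (vspace (on_obj F X) 1) (vspace (on_obj F X) 2)
        (on_hom F X Y f 1) (on_hom F X Y f 2)"
    and hom_lin: "\<And>X Y f i. \<lbrakk>X \<in> Obj C; Y \<in> Obj C; f \<in> carrier (Hom C X Y); i \<in> {1, 2, 3, 4}\<rbrakk>
      \<Longrightarrow> on_hom F X Y f i \<in> lin K (vspace (on_obj F X) i) (vspace (on_obj F Y) i)"
    and gamma: "\<And>X Y f x. \<lbrakk>X \<in> Obj C; Y \<in> Obj C; f \<in> carrier (Hom C X Y);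
        x \<in> carrier (vspace (on_obj F X) 3)\<rbrakk>
      \<Longrightarrow> on_hom F X Y f 0 (vmap (on_obj F X) Gamma x) = vmap (on_obj F Y) Gamma (on_hom F X Y f 3 x)"
    and delta: "\<And>X Y f x. \<lbrakk>X \<in> Obj C; Y \<in> Obj C; f \<in> carrier (Hom C X Y);
        x \<in> carrier (vspace (on_obj F X) 4)\<rbrakk>
      \<Longrightarrow> on_hom F X Y f 0 (vmap (on_obj F X) Delta x) = vmap (on_obj F Y) Delta (on_hom F X Y f 4 x)"
    and ident: "\<And>X i. \<lbrakk>X \<in> Obj C; i \<in> {1, 2, 3, 4}\<rbrakk>
      \<Longrightarrow> on_hom F X X (Ident C X) i = id_map (vspace (on_obj F X) i)"
    and comp: "\<And>X Y Z f g i. \<lbrakk>X \<in> Obj C; Y \<in> Obj C; Z \<in> Obj C;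
        f \<in> carrier (Hom C X Y); g \<in> carrier (Hom C Y Z); i \<in> {1, 2, 3, 4}\<rbrakk>
      \<Longrightarrow> on_hom F X Z (Comp C X Y Z g f) i
        = comp_map (vspace (on_obj F X) i) (on_hom F Y Z g i) (on_hom F X Y f i)"
    and add: "\<And>X Y f g i. \<lbrakk>X \<in> Obj C; Y \<in> Obj C;
        f \<in> carrier (Hom C X Y); g \<in> carrier (Hom C X Y); i \<in> {1, 2, 3, 4}\<rbrakk>
      \<Longrightarrow> on_hom F X Y (f \<otimes>\<^bsub>Hom C X Y\<^esub> g) i
        = add_map (vspace (on_obj F X) i) (vspace (on_obj F Y) i) (on_hom F X Y f i) (on_hom F X Y g i)"
  shows "additive_functor C (rep_cat K quiver_F :: (nat, arrow, 'k, 'a) rep_category) F"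
proof -
  interpret additive_category C by (rule C)
  \<comment> \<open>\<open>One_nat_def\<close> would turn vertex \<open>1\<close> into
    \<open>Suc 0\<close>, and facts stated at \<open>1\<close> would no longer match.\<close>
  note [simp] = space0 alpha beta hom0 and [simp del] = One_nat_def
  have verts: "i = 0 \<or> i \<in> {1, 2, 3, 4}" if "i \<in> verts quiver_F" for i
    using that by (auto simp: quiver_F_def)
  show ?thesis
  proof (rule additive_functor_repI [OF wf_quiver_F C obj])
    have space [simp]: "vspace (on_obj F X) 1 \<in> fdvs K" "vspace (on_obj F X) 2 \<in> fdvs K"
      if "X \<in> Obj C" for X
      using rep_obj_space [OF wf_quiver_F obj [OF that]] by (simp_all add: quiver_F_def)
    fix X Y f
    assume X [simp]: "X \<in> Obj C" and Y [simp]: "Y \<in> Obj C"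
      and f [simp]: "f \<in> carrier (Hom C X Y)"
    note lin12 = hom_lin [OF X Y f, of 1] hom_lin [OF X Y f, of 2]
    show "on_hom F X Y f \<in> rep_mor K quiver_F (on_obj F X) (on_obj F Y)"
      unfolding rep_mor_iff [OF wf_quiver_F obj [OF X] obj [OF Y]]
    proof (intro conjI ballI)
      show "on_hom F X Y f \<in> extensional (verts quiver_F)" by (rule hom_ext [OF X Y f])
      show "on_hom F X Y f i \<in> lin K (vspace (on_obj F X) i) (vspace (on_obj F Y) i)"
        if "i \<in> verts quiver_F" for i
      proof (cases "i = 0")
        case True
        then show ?thesis using lin12 by (simp add: lin_dsum_map)
      next
        case False
        then show ?thesis using verts [OF that] hom_lin [OF X Y f] by blast
      qed
      fix e x assume "e \<in> arcs quiver_F" "x \<in> carrier (vspace (on_obj F X) (tail quiver_F e))"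
      \<comment> \<open>The \<open>lin_zero\<close> facts settle the squares of \<open>Alpha\<close>
        and \<open>Beta\<close>; those of \<open>Gamma\<close> and \<open>Delta\<close> are the
        hypotheses \<open>gamma\<close> and \<open>delta\<close>.\<close>
      then show "on_hom F X Y f (head quiver_F e) (vmap (on_obj F X) e x) =
          vmap (on_obj F Y) e (on_hom F X Y f (tail quiver_F e) x)"
        using gamma [OF X Y f] delta [OF X Y f] lin12
        by (auto simp: quiver_F_def lin_zero [OF _ _ lin12(1)] lin_zero [OF _ _ lin12(2)]
            lin_closed [OF lin12(1)] lin_closed [OF lin12(2)])
    qed
  next
    fix X i assume X: "X \<in> Obj C" and i: "i \<in> verts quiver_F"
    show "on_hom F X X (Ident C X) i = id_map (vspace (on_obj F X) i)"
      using verts [OF i] X ident_closed [OF X] ident by (elim disjE) (simp_all add: ident dsum_map_id)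
  next
    fix X Y Z f g i
    assume X: "X \<in> Obj C" and Y: "Y \<in> Obj C" and Z: "Z \<in> Obj C"
      and f: "f \<in> carrier (Hom C X Y)" and g: "g \<in> carrier (Hom C Y Z)" and i: "i \<in> verts quiver_F"
    note gf = comp_closed [OF X Y Z f g]
    show "on_hom F X Z (Comp C X Y Z g f) i
        = comp_map (vspace (on_obj F X) i) (on_hom F Y Z g i) (on_hom F X Y f i)"
      using verts [OF i]
    proof
      assume "i = 0"
      then show ?thesis
        using X Y Z f g gf
        by (simp add: comp dsum_map_comp [OF hom_lin [OF X Y f, of 1] hom_lin [OF X Y f, of 2]])
    qed (use X Y Z f g comp in blast)
  next
    fix X Y f g i
    assume X: "X \<in> Obj C" and Y: "Y \<in> Obj C"
      and f: "f \<in> carrier (Hom C X Y)" and g: "g \<in> carrier (Hom C X Y)" and i: "i \<in> verts quiver_F"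
    interpret comm_group "Hom C X Y" by (rule hom_comm_group [OF X Y])
    show "on_hom F X Y (f \<otimes>\<^bsub>Hom C X Y\<^esub> g) i
        = add_map (vspace (on_obj F X) i) (vspace (on_obj F Y) i) (on_hom F X Y f i) (on_hom F X Y g i)"
      using verts [OF i]
    proof
      assume "i = 0"
      then show ?thesis using X Y f g m_closed [OF f g] by (simp add: add dsum_map_add)
    qed (use X Y f g add in blast)
  qed
qed

context
  notes [simp del] = One_nat_def \<comment> \<open>keeps vertex 1 from being rewritten to \<open>Suc 0\<close>\<close>
begin

section \<open>Functors on representations of quivers\<close>

lemma rep_obj_quiver_S:
  assumes "V \<in> rep_obj K quiver_S"
  shows "vspace V 1 \<in> fdvs K"
    "vspace V 2 \<in> fdvs K"
    "vspace V 3 \<in> fdvs K"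
    "vspace V 4 \<in> fdvs K"
    and "vmap V Alpha \<in> lin K (vspace V 3) (vspace V 1)"
    "vmap V Beta \<in> lin K (vspace V 3) (vspace V 2)"
    "vmap V Gamma \<in> lin K (vspace V 4) (vspace V 1)"
    "vmap V Delta \<in> lin K (vspace V 4) (vspace V 2)"
  using rep_obj_space [OF wf_quiver_S assms] rep_obj_map [OF wf_quiver_S assms]
  by (force simp: quiver_simps)+

lemma rep_mor_quiver_S:
  assumes "V \<in> rep_obj K quiver_S" "W \<in> rep_obj K quiver_S" "l \<in> rep_mor K quiver_S V W"
  shows "l 1 \<in> lin K (vspace V 1) (vspace W 1)"
    "l 2 \<in> lin K (vspace V 2) (vspace W 2)"
    "l 3 \<in> lin K (vspace V 3) (vspace W 3)"
    "l 4 \<in> lin K (vspace V 4) (vspace W 4)"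
    and "x \<in> carrier (vspace V 3) \<Longrightarrow> l 1 (vmap V Alpha x) = vmap W Alpha (l 3 x)"
    "x \<in> carrier (vspace V 3) \<Longrightarrow> l 2 (vmap V Beta x) = vmap W Beta (l 3 x)"
    "x \<in> carrier (vspace V 4) \<Longrightarrow> l 1 (vmap V Gamma x) = vmap W Gamma (l 4 x)"
    "x \<in> carrier (vspace V 4) \<Longrightarrow> l 2 (vmap V Delta x) = vmap W Delta (l 4 x)"
  using assms(3) unfolding rep_mor_iff [OF wf_quiver_S assms(1,2)]
  by (simp_all add: quiver_simps)

text \<open>In coordinates \<gamma> of the image is
  \<open>x \<mapsto> (f\<^sub>\<alpha> x, f\<^sub>\<beta> x)\<close> and \<delta> is
  \<open>x \<mapsto> (f\<^sub>\<gamma> x, f\<^sub>\<delta> x)\<close>, so each of the two squares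
  splits into two naturality squares of the given morphism.\<close>

lemma functor1_additive:
  "additive_functor (rep_cat K quiver_S)
    (rep_cat K quiver_F :: (nat, arrow, 'k, 'a) rep_category) functor1"
proof (rule additive_functor_quiver_FI [OF rep_cat_additive [OF wf_quiver_S]])
  note functor_simps = functor1_def Let_def
  fix X :: "(nat, arrow, 'k, 'a) rep"
  assume "X \<in> Obj (rep_cat K quiver_S)"
  then have X: "X \<in> rep_obj K quiver_S" by simp
  note [simp] = rep_obj_quiver_S(1-4) [OF X] and mapsX = rep_obj_quiver_S(5-) [OF X]
  \<comment> \<open>\<open>rotated\<close> lets each structure map fill the premise of
    \<open>lin_comp\<close> on the inner map, which fixes the middle space that the conclusion
    leaves open.\<close>
  show "on_obj functor1 X \<in> rep_obj K quiver_F"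
    by (simp add: functor_simps F_rep_obj_iff mapsX [THEN lin_comp [rotated]])
  fix Y :: "(nat, arrow, 'k, 'a) rep" and l
  assume "Y \<in> Obj (rep_cat K quiver_S)" and "l \<in> carrier (Hom (rep_cat K quiver_S) X Y)"
  then have Y: "Y \<in> rep_obj K quiver_S" and l: "l \<in> rep_mor K quiver_S X Y" by simp_all
  note [simp] = rep_obj_quiver_S(1-4) [OF Y] and mapsY = rep_obj_quiver_S(5-) [OF Y]
  note lin = rep_mor_quiver_S(1-4) [OF X Y l] and natural = rep_mor_quiver_S(5-) [OF X Y l]
  note [simp] = mapsX [THEN lin_closed] mapsY [THEN lin_closed] lin [THEN lin_closed]
  show "on_hom functor1 X Y l i \<in> lin K (vspace (on_obj functor1 X) i) (vspace (on_obj functor1 Y) i)"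
    if "i \<in> {1, 2, 3, 4}" for i
    using that by (auto simp: functor_simps lin)
  show "on_hom functor1 X Y l 0 (vmap (on_obj functor1 X) Gamma x) =
      vmap (on_obj functor1 Y) Gamma (on_hom functor1 X Y l 3 x)"
    if "x \<in> carrier (vspace (on_obj functor1 X) 3)" for x
    using that by (simp add: functor_simps natural)
  show "on_hom functor1 X Y l 0 (vmap (on_obj functor1 X) Delta x) =
      vmap (on_obj functor1 Y) Delta (on_hom functor1 X Y l 4 x)"
    if "x \<in> carrier (vspace (on_obj functor1 X) 4)" for x
    using that by (simp add: functor_simps natural)
\<comment> \<open>The remaining obligations hold by unfolding: the components at vertices 1 to 4 are
  those of the given morphism, and identities, composites and sums are formed vertexwise on both
  sides.\<close>
qed (auto simp: functor1_def Let_def F_mor_extensional quiver_simps)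

lemma rep_obj_quiver_D:
  assumes "V \<in> rep_obj K quiver_D"
  shows "vspace V 1 \<in> fdvs K"
    "vspace V 2 \<in> fdvs K"
    "vspace V 3 \<in> fdvs K"
    and "vmap V Alpha \<in> lin K (vspace V 3) (vspace V 1)"
    "vmap V Beta \<in> lin K (vspace V 3) (vspace V 2)"
    "vmap V Gamma \<in> lin K (vspace V 2) (vspace V 1)"
  using rep_obj_space [OF wf_quiver_D assms] rep_obj_map [OF wf_quiver_D assms]
  by (force simp: quiver_simps)+

lemma rep_mor_quiver_D:
  assumes "V \<in> rep_obj K quiver_D" "W \<in> rep_obj K quiver_D" "l \<in> rep_mor K quiver_D V W"
  shows "l 1 \<in> lin K (vspace V 1) (vspace W 1)"
    "l 2 \<in> lin K (vspace V 2) (vspace W 2)"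
    "l 3 \<in> lin K (vspace V 3) (vspace W 3)"
    and "x \<in> carrier (vspace V 3) \<Longrightarrow> l 1 (vmap V Alpha x) = vmap W Alpha (l 3 x)"
    "x \<in> carrier (vspace V 3) \<Longrightarrow> l 2 (vmap V Beta x) = vmap W Beta (l 3 x)"
    "x \<in> carrier (vspace V 2) \<Longrightarrow> l 1 (vmap V Gamma x) = vmap W Gamma (l 2 x)"
  using assms(3) unfolding rep_mor_iff [OF wf_quiver_D assms(1,2)]
  by (simp_all add: quiver_simps)

text \<open>Here \<delta> of the image is \<open>y \<mapsto> (f\<^sub>\<gamma> y, y)\<close>, the
  graph of the map along \<gamma>. Its second coordinate commutes because the component at vertex 4
  is \<open>l 2\<close>; the first is naturality along \<gamma>.\<close>

lemma functor2_additive: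
  "additive_functor (rep_cat K quiver_D)
    (rep_cat K quiver_F :: (nat, arrow, 'k, 'a) rep_category) functor2"
proof (rule additive_functor_quiver_FI [OF rep_cat_additive [OF wf_quiver_D]])
  note functor_simps = functor2_def Let_def
  fix X :: "(nat, arrow, 'k, 'a) rep"
  assume "X \<in> Obj (rep_cat K quiver_D)"
  then have X: "X \<in> rep_obj K quiver_D" by simp
  note [simp] = rep_obj_quiver_D(1-3) [OF X] and mapsX = rep_obj_quiver_D(4-) [OF X]
  show "on_obj functor2 X \<in> rep_obj K quiver_F"
    by (simp add: functor_simps F_rep_obj_iff mapsX [THEN lin_comp [rotated]])
  fix Y :: "(nat, arrow, 'k, 'a) rep" and l
  assume "Y \<in> Obj (rep_cat K quiver_D)" and "l \<in> carrier (Hom (rep_cat K quiver_D) X Y)"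
  then have Y: "Y \<in> rep_obj K quiver_D" and l: "l \<in> rep_mor K quiver_D X Y" by simp_all
  note [simp] = rep_obj_quiver_D(1-3) [OF Y] and mapsY = rep_obj_quiver_D(4-) [OF Y]
  note lin = rep_mor_quiver_D(1-3) [OF X Y l] and natural = rep_mor_quiver_D(4-) [OF X Y l]
  note [simp] = mapsX [THEN lin_closed] mapsY [THEN lin_closed] lin [THEN lin_closed]
  show "on_hom functor2 X Y l i \<in> lin K (vspace (on_obj functor2 X) i) (vspace (on_obj functor2 Y) i)"
    if "i \<in> {1, 2, 3, 4}" for i
    using that by (auto simp: functor_simps lin)
  show "on_hom functor2 X Y l 0 (vmap (on_obj functor2 X) Gamma x) =
      vmap (on_obj functor2 Y) Gamma (on_hom functor2 X Y l 3 x)"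
    if "x \<in> carrier (vspace (on_obj functor2 X) 3)" for x
    using that by (simp add: functor_simps natural)
  show "on_hom functor2 X Y l 0 (vmap (on_obj functor2 X) Delta x) =
      vmap (on_obj functor2 Y) Delta (on_hom functor2 X Y l 4 x)"
    if "x \<in> carrier (vspace (on_obj functor2 X) 4)" for x
    using that by (simp add: functor_simps natural)
qed (auto simp: functor2_def Let_def F_mor_extensional quiver_simps)

lemma rep_obj_quiver_K:
  assumes "V \<in> rep_obj K quiver_K"
  shows "vspace V 1 \<in> fdvs K"
    "vspace V 2 \<in> fdvs K"
    and "vmap V Alpha \<in> lin K (vspace V 2) (vspace V 1)"
    "vmap V Beta \<in> lin K (vspace V 2) (vspace V 1)"
  using rep_obj_space [OF wf_quiver_K assms] rep_obj_map [OF wf_quiver_K assms]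
  by (force simp: quiver_simps)+

lemma rep_mor_quiver_K:
  assumes "V \<in> rep_obj K quiver_K" "W \<in> rep_obj K quiver_K" "l \<in> rep_mor K quiver_K V W"
  shows "l 1 \<in> lin K (vspace V 1) (vspace W 1)"
    "l 2 \<in> lin K (vspace V 2) (vspace W 2)"
    and "x \<in> carrier (vspace V 2) \<Longrightarrow> l 1 (vmap V Alpha x) = vmap W Alpha (l 2 x)"
    "x \<in> carrier (vspace V 2) \<Longrightarrow> l 1 (vmap V Beta x) = vmap W Beta (l 2 x)"
  using assms(3) unfolding rep_mor_iff [OF wf_quiver_K assms(1,2)]
  by (simp_all add: quiver_simps)

text \<open>Both \<gamma> and \<delta> of the image are graphs,
  \<open>y \<mapsto> (f\<^sub>\<alpha> y, y)\<close> and
  \<open>y \<mapsto> (f\<^sub>\<beta> y, y)\<close>, so each square reduces to naturality along one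
  arrow.\<close>

lemma functor3_additive:
  "additive_functor (rep_cat K quiver_K)
    (rep_cat K quiver_F :: (nat, arrow, 'k, 'a) rep_category) functor3"
proof (rule additive_functor_quiver_FI [OF rep_cat_additive [OF wf_quiver_K]])
  note functor_simps = functor3_def Let_def
  fix X :: "(nat, arrow, 'k, 'a) rep"
  assume "X \<in> Obj (rep_cat K quiver_K)"
  then have X: "X \<in> rep_obj K quiver_K" by simp
  note [simp] = rep_obj_quiver_K(1-2) [OF X] and mapsX = rep_obj_quiver_K(3-) [OF X]
  show "on_obj functor3 X \<in> rep_obj K quiver_F"
    by (simp add: functor_simps F_rep_obj_iff mapsX [THEN lin_comp [rotated]])
  fix Y :: "(nat, arrow, 'k, 'a) rep" and l
  assume "Y \<in> Obj (rep_cat K quiver_K)" and "l \<in> carrier (Hom (rep_cat K quiver_K) X Y)"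
  then have Y: "Y \<in> rep_obj K quiver_K" and l: "l \<in> rep_mor K quiver_K X Y" by simp_all
  note [simp] = rep_obj_quiver_K(1-2) [OF Y] and mapsY = rep_obj_quiver_K(3-) [OF Y]
  note lin = rep_mor_quiver_K(1-2) [OF X Y l] and natural = rep_mor_quiver_K(3-) [OF X Y l]
  note [simp] = mapsX [THEN lin_closed] mapsY [THEN lin_closed] lin [THEN lin_closed]
  show "on_hom functor3 X Y l i \<in> lin K (vspace (on_obj functor3 X) i) (vspace (on_obj functor3 Y) i)"
    if "i \<in> {1, 2, 3, 4}" for i
    using that by (auto simp: functor_simps lin)
  show "on_hom functor3 X Y l 0 (vmap (on_obj functor3 X) Gamma x) =
      vmap (on_obj functor3 Y) Gamma (on_hom functor3 X Y l 3 x)"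
    if "x \<in> carrier (vspace (on_obj functor3 X) 3)" for x
    using that by (simp add: functor_simps natural)
  show "on_hom functor3 X Y l 0 (vmap (on_obj functor3 X) Delta x) =
      vmap (on_obj functor3 Y) Delta (on_hom functor3 X Y l 4 x)"
    if "x \<in> carrier (vspace (on_obj functor3 X) 4)" for x
    using that by (simp add: functor_simps natural)
qed (auto simp: functor3_def Let_def F_mor_extensional quiver_simps)

lemma rep_obj_quiver_C:
  assumes "V \<in> rep_obj K quiver_C"
  shows "vspace V 1 \<in> fdvs K"
    "vspace V 2 \<in> fdvs K"
    and "vmap V Alpha \<in> lin K (vspace V 2) (vspace V 1)"
    "vmap V Beta \<in> lin K (vspace V 1) (vspace V 2)"
  using rep_obj_space [OF wf_quiver_C assms] rep_obj_map [OF wf_quiver_C assms]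
  by (force simp: quiver_simps)+

lemma rep_mor_quiver_C:
  assumes "V \<in> rep_obj K quiver_C" "W \<in> rep_obj K quiver_C" "l \<in> rep_mor K quiver_C V W"
  shows "l 1 \<in> lin K (vspace V 1) (vspace W 1)"
    "l 2 \<in> lin K (vspace V 2) (vspace W 2)"
    and "x \<in> carrier (vspace V 2) \<Longrightarrow> l 1 (vmap V Alpha x) = vmap W Alpha (l 2 x)"
    "x \<in> carrier (vspace V 1) \<Longrightarrow> l 2 (vmap V Beta x) = vmap W Beta (l 1 x)"
  using assms(3) unfolding rep_mor_iff [OF wf_quiver_C assms(1,2)]
  by (simp_all add: quiver_simps)

text \<open>The two graphs now point in opposite directions,
  \<open>x \<mapsto> (x, f\<^sub>\<beta> x)\<close> and
  \<open>y \<mapsto> (f\<^sub>\<alpha> y, y)\<close>, which is why the components at vertices 3 and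
  4 are \<open>l 1\<close> and \<open>l 2\<close>.\<close>

lemma functor4_additive:
  "additive_functor (rep_cat K quiver_C)
    (rep_cat K quiver_F :: (nat, arrow, 'k, 'a) rep_category) functor4"
proof (rule additive_functor_quiver_FI [OF rep_cat_additive [OF wf_quiver_C]])
  note functor_simps = functor4_def Let_def
  fix X :: "(nat, arrow, 'k, 'a) rep"
  assume "X \<in> Obj (rep_cat K quiver_C)"
  then have X: "X \<in> rep_obj K quiver_C" by simp
  note [simp] = rep_obj_quiver_C(1-2) [OF X] and mapsX = rep_obj_quiver_C(3-) [OF X]
  show "on_obj functor4 X \<in> rep_obj K quiver_F"
    by (simp add: functor_simps F_rep_obj_iff mapsX [THEN lin_comp [rotated]])
  fix Y :: "(nat, arrow, 'k, 'a) rep" and l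
  assume "Y \<in> Obj (rep_cat K quiver_C)" and "l \<in> carrier (Hom (rep_cat K quiver_C) X Y)"
  then have Y: "Y \<in> rep_obj K quiver_C" and l: "l \<in> rep_mor K quiver_C X Y" by simp_all
  note [simp] = rep_obj_quiver_C(1-2) [OF Y] and mapsY = rep_obj_quiver_C(3-) [OF Y]
  note lin = rep_mor_quiver_C(1-2) [OF X Y l] and natural = rep_mor_quiver_C(3-) [OF X Y l]
  note [simp] = mapsX [THEN lin_closed] mapsY [THEN lin_closed] lin [THEN lin_closed]
  show "on_hom functor4 X Y l i \<in> lin K (vspace (on_obj functor4 X) i) (vspace (on_obj functor4 Y) i)"
    if "i \<in> {1, 2, 3, 4}" for i
    using that by (auto simp: functor_simps lin)
  show "on_hom functor4 X Y l 0 (vmap (on_obj functor4 X) Gamma x) =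
      vmap (on_obj functor4 Y) Gamma (on_hom functor4 X Y l 3 x)"
    if "x \<in> carrier (vspace (on_obj functor4 X) 3)" for x
    using that by (simp add: functor_simps natural)
  show "on_hom functor4 X Y l 0 (vmap (on_obj functor4 X) Delta x) =
      vmap (on_obj functor4 Y) Delta (on_hom functor4 X Y l 4 x)"
    if "x \<in> carrier (vspace (on_obj functor4 X) 4)" for x
    using that by (simp add: functor_simps natural)
qed (auto simp: functor4_def Let_def F_mor_extensional quiver_simps)


section \<open>Functors on linear relations\<close>

lemma subspace_rel_subset:
  assumes "VectorSpace.subspace K R (dsum V W)"
  shows "R \<subseteq> carrier (dsum V W)"
  using assms by (simp add: VectorSpace.subspace_def submodule_def)

lemma lin_inclusion:
  assumes "VectorSpace.subspace K R (dsum V W)"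
  shows "(\<lambda>p\<in>R. p) \<in> lin K (dsum V W\<lparr>carrier := R\<rparr>) (dsum V W)"
proof -
  interpret submodule K R "dsum V W" using assms by (simp add: VectorSpace.subspace_def)
  show ?thesis using subset m_closed smult_closed by (auto simp: lin_iff)
qed

lemma rel_map_dsum_map:
  assumes "VectorSpace.subspace K R (dsum V W)" "rel_map R S l m" "p \<in> R"
  shows "dsum_map V W l m p \<in> S"
  using assms(2,3) subspace_rel_subset [OF assms(1)] by (auto simp: rel_map_def elim!: dsumE)

lemma lin_restrict:
  assumes R: "VectorSpace.subspace K R (dsum V W)"
    and f: "f \<in> lin K (dsum V W) (dsum V' W')" and S: "\<And>p. p \<in> R \<Longrightarrow> f p \<in> S"
  shows "restrict f R \<in> lin K (dsum V W\<lparr>carrier := R\<rparr>) (dsum V' W'\<lparr>carrier := S\<rparr>)"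
proof -
  interpret submodule K R "dsum V W" using R by (simp add: VectorSpace.subspace_def)
  show ?thesis
    using subset m_closed smult_closed lin_add [OF f] lin_smult [OF f] S
    by (simp add: lin_iff subset_iff)
qed

lemma restrict_dsum_map_id:
  assumes "VectorSpace.subspace K R (dsum V W)"
  shows "restrict (dsum_map V W (id_map V) (id_map W)) R = id_map (dsum V W\<lparr>carrier := R\<rparr>)"
proof (rule extensionalityI [where A = R])
  show "restrict (dsum_map V W (id_map V) (id_map W)) R p = id_map (dsum V W\<lparr>carrier := R\<rparr>) p"
    if "p \<in> R" for p
    using that subspace_rel_subset [OF assms] unfolding dsum_map_id by (auto simp: subset_iff)
qed (simp_all add: id_map_def)

text \<open>The hypothesis \<open>rel_map R S l l'\<close> keeps the image of \<open>R\<close>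
  inside \<open>S\<close>, so the restricted outer map is never evaluated where it is
  \<open>undefined\<close>.\<close>

lemma restrict_dsum_map_comp:
  assumes R: "VectorSpace.subspace K R (dsum U U')"
    and l: "l \<in> lin K U V" and l': "l' \<in> lin K U' V'" and S: "rel_map R S l l'"
  shows "restrict (dsum_map U U' (comp_map U m l) (comp_map U' m' l')) R =
    comp_map (dsum U U'\<lparr>carrier := R\<rparr>) (restrict (dsum_map V V' m m') S)
      (restrict (dsum_map U U' l l') R)"
proof -
  have "dsum_map U U' (comp_map U m l) (comp_map U' m' l') p
      = dsum_map V V' m m' (dsum_map U U' l l' p)" if "p \<in> R" for p
    using that subspace_rel_subset [OF R] l l' by (subst dsum_map_comp [OF l l']) auto
  then show ?thesis
    using rel_map_dsum_map [OF R S] by (auto simp: comp_map_def compose_def intro!: restrict_ext)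
qed

lemma restrict_dsum_map_add:
  assumes R: "VectorSpace.subspace K R (dsum V W)"
  shows "restrict (dsum_map V W (add_map V V' l m) (add_map W W' l' m')) R =
    add_map (dsum V W\<lparr>carrier := R\<rparr>) (dsum V' W'\<lparr>carrier := S\<rparr>)
      (restrict (dsum_map V W l l') R) (restrict (dsum_map V W m m') R)"
proof -
  have "dsum_map V W (add_map V V' l m) (add_map W W' l' m') p
      = dsum_map V W l l' p \<oplus>\<^bsub>dsum V' W'\<^esub> dsum_map V W m m' p" if "p \<in> R" for p
    using that subspace_rel_subset [OF R] unfolding dsum_map_add by (auto simp: subset_iff)
  then show ?thesis by (auto simp: add_map_def intro!: restrict_ext)
qed

text \<open>The map \<gamma> of the image is the diagonal \<open>x \<mapsto> (x, x)\<close>, which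
  \<open>l \<oplus> l\<close> carries to the diagonal of the target. The square of \<delta> commutes
  because \<open>l \<oplus> l\<close> maps \<open>R\<close> into \<open>S\<close>, so restricting
  before or after the inclusion gives the same vector.\<close>

lemma functor5_additive:
  "additive_functor (lrel_cat K) (rep_cat K quiver_F :: (nat, arrow, 'k, 'a) rep_category) functor5"
proof (rule additive_functor_quiver_FI [OF lrel_cat_additive])
  note functor_simps = functor5_def Let_def
  fix X :: "('k, 'a) lrel_object"
  assume X': "X \<in> Obj (lrel_cat K)"
  obtain V R where X: "X = (V, R)" by fastforce
  with X' have V [simp]: "V \<in> fdvs K" and R: "VectorSpace.subspace K R (dsum V V)" by auto
  note [simp] = fdvs_subspace [OF dsum_fdvs [OF V V] R] lin_inclusion [OF R]
    subspace_rel_subset [OF R, THEN subsetD] rel_map_dsum_map [OF R]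
  show "on_obj functor5 X \<in> rep_obj K quiver_F"
    by (simp add: X functor_simps F_rep_obj_iff)
  show "on_hom functor5 X X (Ident (lrel_cat K) X) i = id_map (vspace (on_obj functor5 X) i)"
    if "i \<in> {1, 2, 3, 4}" for i
    using that by (auto simp: X functor_simps restrict_dsum_map_id [OF R])
  fix Y :: "('k, 'a) lrel_object" and l
  assume Y': "Y \<in> Obj (lrel_cat K)" and l': "l \<in> carrier (Hom (lrel_cat K) X Y)"
  obtain W S where Y: "Y = (W, S)" by fastforce
  with Y' l' X have W [simp]: "W \<in> fdvs K" and S: "VectorSpace.subspace K S (dsum W W)"
    and l [simp]: "l \<in> lin K V W" and lS: "rel_map R S l l" by auto
  show "on_hom functor5 X Y l i \<in> lin K (vspace (on_obj functor5 X) i) (vspace (on_obj functor5 Y) i)"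
    if "i \<in> {1, 2, 3, 4}" for i
    using that rel_map_dsum_map [OF R lS] by (auto simp: X Y functor_simps intro!: lin_restrict [OF R])
  show "on_hom functor5 X Y l 0 (vmap (on_obj functor5 X) Gamma x) =
      vmap (on_obj functor5 Y) Gamma (on_hom functor5 X Y l 3 x)"
    if "x \<in> carrier (vspace (on_obj functor5 X) 3)" for x
    using that by (simp add: X Y functor_simps lin_closed [OF l])
  show "on_hom functor5 X Y l 0 (vmap (on_obj functor5 X) Delta x) =
      vmap (on_obj functor5 Y) Delta (on_hom functor5 X Y l 4 x)"
    if "x \<in> carrier (vspace (on_obj functor5 X) 4)" for x
    using that rel_map_dsum_map [OF R lS] by (simp add: X Y functor_simps)
  show "on_hom functor5 X Y (l \<otimes>\<^bsub>Hom (lrel_cat K) X Y\<^esub> m) i =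
      add_map (vspace (on_obj functor5 X) i) (vspace (on_obj functor5 Y) i)
        (on_hom functor5 X Y l i) (on_hom functor5 X Y m i)"
    if "i \<in> {1, 2, 3, 4}" for m i
    using that by (auto simp: X Y functor_simps restrict_dsum_map_add [OF R])
  fix Z :: "('k, 'a) lrel_object" and m
  obtain U T where Z: "Z = (U, T)" by fastforce
  show "on_hom functor5 X Z (Comp (lrel_cat K) X Y Z m l) i =
      comp_map (vspace (on_obj functor5 X) i) (on_hom functor5 Y Z m i) (on_hom functor5 X Y l i)"
    if "i \<in> {1, 2, 3, 4}" for i
    using that by (auto simp: X Y Z functor_simps restrict_dsum_map_comp [OF R l l lS])
qed (auto simp: functor5_def Let_def F_mor_extensional)

text \<open>Both \<gamma> and \<delta> of the image are inclusions of relations, so each square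
  rests on the preservation of one of the two relations by the pair.\<close>

lemma functor6_additive:
  "additive_functor (lrel2_cat K) (rep_cat K quiver_F :: (nat, arrow, 'k, 'a) rep_category) functor6"
proof (rule additive_functor_quiver_FI [OF lrel2_cat_additive])
  note functor_simps = functor6_def Let_def
  fix X :: "('k, 'a) lrel2_object"
  assume X': "X \<in> Obj (lrel2_cat K)"
  obtain V1 V2 R1 R2 where X: "X = (V1, V2, R1, R2)" by (metis surj_pair)
  with X' have V [simp]: "V1 \<in> fdvs K" "V2 \<in> fdvs K"
    and R1: "VectorSpace.subspace K R1 (dsum V1 V2)" and R2: "VectorSpace.subspace K R2 (dsum V1 V2)"
    by auto
  note [simp] = fdvs_subspace [OF dsum_fdvs [OF V] R1] fdvs_subspace [OF dsum_fdvs [OF V] R2]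
    lin_inclusion [OF R1] lin_inclusion [OF R2]
  show "on_obj functor6 X \<in> rep_obj K quiver_F"
    by (simp add: X functor_simps F_rep_obj_iff)
  show "on_hom functor6 X X (Ident (lrel2_cat K) X) i = id_map (vspace (on_obj functor6 X) i)"
    if "i \<in> {1, 2, 3, 4}" for i
    using that by (auto simp: X functor_simps restrict_dsum_map_id [OF R1] restrict_dsum_map_id [OF R2])
  fix Y :: "('k, 'a) lrel2_object" and l
  assume Y': "Y \<in> Obj (lrel2_cat K)" and l': "l \<in> carrier (Hom (lrel2_cat K) X Y)"
  obtain W1 W2 S1 S2 where Y: "Y = (W1, W2, S1, S2)" by (metis surj_pair)
  obtain l1 l2 where l: "l = (l1, l2)" by fastforce
  from Y' l' X Y l have [simp]: "W1 \<in> fdvs K" "W2 \<in> fdvs K"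
    and l1 [simp]: "l1 \<in> lin K V1 W1" and l2 [simp]: "l2 \<in> lin K V2 W2"
    and lS1: "rel_map R1 S1 l1 l2" and lS2: "rel_map R2 S2 l1 l2" by auto
  note lS = rel_map_dsum_map [OF R1 lS1] rel_map_dsum_map [OF R2 lS2]
  show "on_hom functor6 X Y l i \<in> lin K (vspace (on_obj functor6 X) i) (vspace (on_obj functor6 Y) i)"
    if "i \<in> {1, 2, 3, 4}" for i
    using that lS
    by (auto simp: X Y l functor_simps intro!: lin_restrict [OF R1] lin_restrict [OF R2])
  show "on_hom functor6 X Y l 0 (vmap (on_obj functor6 X) Gamma x) =
      vmap (on_obj functor6 Y) Gamma (on_hom functor6 X Y l 3 x)"
    if "x \<in> carrier (vspace (on_obj functor6 X) 3)" for x
    using that lS by (simp add: X Y l functor_simps)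
  show "on_hom functor6 X Y l 0 (vmap (on_obj functor6 X) Delta x) =
      vmap (on_obj functor6 Y) Delta (on_hom functor6 X Y l 4 x)"
    if "x \<in> carrier (vspace (on_obj functor6 X) 4)" for x
    using that lS by (simp add: X Y l functor_simps)
  show "on_hom functor6 X Y (l \<otimes>\<^bsub>Hom (lrel2_cat K) X Y\<^esub> m) i =
      add_map (vspace (on_obj functor6 X) i) (vspace (on_obj functor6 Y) i)
        (on_hom functor6 X Y l i) (on_hom functor6 X Y m i)"
    if "i \<in> {1, 2, 3, 4}" for m i
    using that
    by (cases m) (auto simp: X Y l functor_simps
        restrict_dsum_map_add [OF R1] restrict_dsum_map_add [OF R2])
  fix Z :: "('k, 'a) lrel2_object" and m :: "'a map \<times> 'a map"
  obtain U1 U2 T1 T2 where Z: "Z = (U1, U2, T1, T2)" by (metis surj_pair)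
  obtain m1 m2 where m: "m = (m1, m2)" by fastforce
  show "on_hom functor6 X Z (Comp (lrel2_cat K) X Y Z m l) i =
      comp_map (vspace (on_obj functor6 X) i) (on_hom functor6 Y Z m i) (on_hom functor6 X Y l i)"
    if "i \<in> {1, 2, 3, 4}" for i
    using that
    by (auto simp: X Y Z l m functor_simps restrict_dsum_map_comp [OF R1 l1 l2 lS1]
        restrict_dsum_map_comp [OF R2 l1 l2 lS2])
qed (auto simp: functor6_def Let_def F_mor_extensional)

end

end

theorem theorem14:
  fixes K :: "'k ring"
  assumes "field K"
  shows
    "additive_functor (rep_cat K quiver_S)
       (rep_cat K quiver_F :: (nat, arrow, 'k, 'a) rep_category) functor1 \<and>
     additive_functor (rep_cat K quiver_D)
       (rep_cat K quiver_F :: (nat, arrow, 'k, 'a) rep_category) functor2 \<and>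
     additive_functor (rep_cat K quiver_K)
       (rep_cat K quiver_F :: (nat, arrow, 'k, 'a) rep_category) functor3 \<and>
     additive_functor (rep_cat K quiver_C)
       (rep_cat K quiver_F :: (nat, arrow, 'k, 'a) rep_category) functor4 \<and>
     additive_functor (lrel_cat K)
       (rep_cat K quiver_F :: (nat, arrow, 'k, 'a) rep_category) functor5 \<and>
     additive_functor (lrel2_cat K)
       (rep_cat K quiver_F :: (nat, arrow, 'k, 'a) rep_category) functor6"
proof -
  interpret ground_field K using assms by (rule ground_field.intro)
  show ?thesis
    using functor1_additive functor2_additive functor3_additive functor4_additive
      functor5_additive functor6_additive by blast
qed

end
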